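(* $\mathrm{BMO}_{2s}$ is the dual of $H^1_{2s}$. More precisely, there is an absolute constant $c$ such that for every $\varphi\in\mathrm{BMO}_{2s}$ the functional $L_\varphi$, defined initially for bounded compactly supported functions $f\in H^1_{2s}$ by $$L_\varphi(f)=\int_{\mathbb{R}}f(x)\varphi(x)\,dx,$$ has a bounded extension to $H^1_{2s}$ with norm at most $c\,\|\varphi\|_{*,2s}$. Moreover, for every bounded linear functional $L\in(H^1_{2s})^*$ there is $\varphi\in\mathrm{BMO}_{2s}$ with $\|\varphi\|_{*,2s}\sim\|L\|$ (each is bounded by an absolute constant times the other) such that $L(f)=L_\varphi(f)=\int_{\mathbb{R}}f(x)\varphi(x)\,dx$ for every compactly supported bounded $f\in H^1_{2s}$.
   Context: All functions are on $\mathbb{R}$. An atom with defining interval $I$ (a bounded interval) is a function $a$ with $\operatorname{supp}(a)\subseteq I$, $|a(x)|\le 1/|I|$ and $\int_I a(x)\,dx=0$. $H^1_{2s}$ (two-sided $H^1$) is the Banach space of all $f=\sum_{j=1}^\infty\lambda_j a_j$ (convergence in $L^1$ and in the sense of distributions) with $\sum_j|\lambda_j|<\infty$, where the $a_j$ are atoms whose defining interval lies on one side of the origin (is contained in $(-\infty,0]$ or in $[0,\infty)$), normed by $\|f\|_{H^1_{2s}}=\inf\sum_j|\lambda_j|$ over all such decompositions. $\mathrm{BMO}_{2s}$ (two-sided BMO) is the space of locally integrable $\varphi$ with $$\|\varphi\|_{*,2s}=\sup_I\frac1{|I|}\int_I|\varphi(x)-\varphi_I|\,dx<\infty,\qquad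 \varphi_I=\frac1{|I|}\int_I\varphi,$$ the supremum being over bounded intervals $I$ lying on one side of the origin; it is a Banach space modulo two constants (one for each side of the origin). *)

theory Defs
  imports "HOL-Analysis.Analysis"
begin

text \<open>
  The scalars range over a type \<open>'a :: {real_normed_field, euclidean_space}\<close>, so that the real-valued
  and the complex-valued theory (\<open>'a = real\<close> and \<open>'a = complex\<close>) are covered simultaneously.
  Elements of function spaces are represented by honest functions rather than by classes modulo
  null sets; all the notions below that concern spaces and norms are invariant under changing a
  function on a Lebesgue null set.
\<close>

text \<open>Intervals may be open, closed or half-open. Those of length zero are excluded, because the
  definitions divide by the length.\<close>

definition bounded_interval :: "real set \<Rightarrow> bool" where
  "bounded_interval I \<longleftrightarrow> is_interval I \<and> bounded I \<and> 0 < measure lebesgue I"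

definition one_sided_intervals :: "real set set" where
  "one_sided_intervals = {I. bounded_interval I \<and> (I \<subseteq> {..0} \<or> I \<subseteq> {0..})}"

definition supp :: "(real \<Rightarrow> 'a::{real_normed_field, euclidean_space}) \<Rightarrow> real set" where
  "supp f = closure {x. f x \<noteq> 0}"

definition atom_on :: "real set \<Rightarrow> (real \<Rightarrow> 'a::{real_normed_field, euclidean_space}) \<Rightarrow> bool" where
  "atom_on I a \<longleftrightarrow>
     bounded_interval I \<and> a \<in> borel_measurable lebesgue \<and> supp a \<subseteq> I \<and>
     (\<forall>x. norm (a x) \<le> 1 / measure lebesgue I) \<and> (LINT x:I|lebesgue. a x) = 0"

text \<open>The series is required to converge in \<open>L\<^sup>1\<close>; this implies convergence in the sense of
  distributions to the same limit.\<close>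

definition atomic_decomp_2s ::
    "(real \<Rightarrow> 'a::{real_normed_field, euclidean_space}) \<Rightarrow> (nat \<Rightarrow> 'a) \<Rightarrow> (nat \<Rightarrow> real \<Rightarrow> 'a) \<Rightarrow> bool" where
  "atomic_decomp_2s f c a \<longleftrightarrow>
     (\<forall>j. \<exists>I\<in>one_sided_intervals. atom_on I (a j)) \<and>
     summable (\<lambda>j. norm (c j)) \<and>
     integrable lebesgue f \<and>
     (\<lambda>n. LINT x|lebesgue. norm (f x - (\<Sum>j<n. c j * a j x))) \<longlonglongrightarrow> 0"

definition H1_2s :: "(real \<Rightarrow> 'a::{real_normed_field, euclidean_space}) set" where
  "H1_2s = {f. \<exists>c a. atomic_decomp_2s f c a}"

definition norm_H1_2s :: "(real \<Rightarrow> 'a::{real_normed_field, euclidean_space}) \<Rightarrow> real" where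
  "norm_H1_2s f = Inf {\<Sum>j. norm (c j) | c a. atomic_decomp_2s f c a}"

definition locally_integrable :: "(real \<Rightarrow> 'a::{real_normed_field, euclidean_space}) \<Rightarrow> bool" where
  "locally_integrable \<phi> \<longleftrightarrow> (\<forall>K. compact K \<longrightarrow> set_integrable lebesgue K \<phi>)"

definition mean_on :: "real set \<Rightarrow> (real \<Rightarrow> 'a::{real_normed_field, euclidean_space}) \<Rightarrow> 'a" where
  "mean_on I \<phi> = (1 / measure lebesgue I) *\<^sub>R (LINT x:I|lebesgue. \<phi> x)"

definition mean_osc :: "real set \<Rightarrow> (real \<Rightarrow> 'a::{real_normed_field, euclidean_space}) \<Rightarrow> real" where
  "mean_osc I \<phi> = (1 / measure lebesgue I) * (LINT x:I|lebesgue. norm (\<phi> x - mean_on I \<phi>))"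

definition BMO_2s :: "(real \<Rightarrow> 'a::{real_normed_field, euclidean_space}) set" where
  "BMO_2s = {\<phi>. locally_integrable \<phi> \<and> bdd_above ((\<lambda>I. mean_osc I \<phi>) ` one_sided_intervals)}"

definition norm_BMO_2s :: "(real \<Rightarrow> 'a::{real_normed_field, euclidean_space}) \<Rightarrow> real" where
  "norm_BMO_2s \<phi> = (SUP I\<in>one_sided_intervals. mean_osc I \<phi>)"

text \<open>A functional is a function on all of \<open>real \<Rightarrow> 'a\<close> of which only the values on \<open>H1_2s\<close> matter.
  Boundedness forces equal values on functions that agree almost everywhere.\<close>

definition dual_H1_2s :: "((real \<Rightarrow> 'a::{real_normed_field, euclidean_space}) \<Rightarrow> 'a) set" where
  "dual_H1_2s = {L.
     (\<forall>f\<in>H1_2s. \<forall>g\<in>H1_2s. L (\<lambda>x. f x + g x) = L f + L g) \<and>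
     (\<forall>k. \<forall>f\<in>H1_2s. L (\<lambda>x. k * f x) = k * L f) \<and>
     (\<exists>B. \<forall>f\<in>H1_2s. norm (L f) \<le> B * norm_H1_2s f)}"

definition norm_dual_H1_2s ::
    "((real \<Rightarrow> 'a::{real_normed_field, euclidean_space}) \<Rightarrow> 'a) \<Rightarrow> real" where
  "norm_dual_H1_2s L = (SUP f\<in>{f \<in> H1_2s. norm_H1_2s f \<le> 1}. norm (L f))"

definition bounded_compactly_supported ::
    "(real \<Rightarrow> 'a::{real_normed_field, euclidean_space}) \<Rightarrow> bool" where
  "bounded_compactly_supported f \<longleftrightarrow> bounded (range f) \<and> compact (supp f)"

text \<open>For bounded compactly supported measurable \<open>f\<close> and locally integrable \<open>\<phi>\<close> the integrand is
  integrable, so the Bochner integral is not a junk value.\<close>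

definition L_functional ::
    "(real \<Rightarrow> 'a::{real_normed_field, euclidean_space}) \<Rightarrow> (real \<Rightarrow> 'a) \<Rightarrow> 'a" where
  "L_functional \<phi> f = (LINT x|lebesgue. f x * \<phi> x)"

end

theory Submission
  imports Defs
begin

text \<open>
  One atom and one function of bounded mean oscillation pair easily: the atom \<open>a\<close> on \<open>I\<close> has mean zero,
  so \<open>\<bar>\<integral>a \<phi>\<bar> = \<bar>\<integral>a (\<phi> - \<phi>\<^sub>I)\<bar>\<close> is at most the mean oscillation of \<open>\<phi>\<close> on \<open>I\<close>. The difficulty with a sum
  \<open>f = \<Sum>\<^sub>j \<lambda>\<^sub>j a\<^sub>j\<close> is that the series converges only in \<open>L\<^sup>1\<close>, so that \<open>\<integral>f \<phi>\<close> cannot be computed term by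
  term when \<open>\<phi>\<close> is unbounded, and it is not clear that \<open>\<Sum>\<^sub>j \<lambda>\<^sub>j \<integral>a\<^sub>j \<phi>\<close> depends on \<open>f\<close> alone. Both
  points are settled by truncation. Projecting the values of \<open>\<phi>\<close> onto the ball of radius \<open>N\<close> is a
  contraction, hence the truncations \<open>\<phi>\<^sub>N\<close> satisfy the same bound on atoms
  (\<open>atom_pairing_le\<close>). Since \<open>\<phi>\<^sub>N\<close> is bounded, \<open>\<integral>f \<phi>\<^sub>N = \<Sum>\<^sub>j \<lambda>\<^sub>j \<integral>a\<^sub>j \<phi>\<^sub>N\<close>, and dominated convergence for
  series shows that the limit in \<open>N\<close> exists and equals \<open>\<Sum>\<^sub>j \<lambda>\<^sub>j \<integral>a\<^sub>j \<phi>\<close> for every decomposition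
  (\<open>truncation_pairing_sums\<close>). This limit is the required extension, with constant 1.

  Conversely, let \<open>L\<close> be a bounded functional. Subtracting multiples of the indicators of \<open>[0,1)\<close> and
  \<open>[-1,0)\<close> turns any bounded measurable function of bounded support into one that has mean zero on each half-line
  and is thus a combination of two atoms. In this way \<open>L\<close> extends to a linear functional on
  all such functions, in particular to a finitely additive set function on each interval
  \<open>[n,n+1)\<close>. If it is countably additive and vanishes on null sets, then the Radon--Nikodym theorem,
  applied to its coordinates, yields the density \<open>\<phi>\<close>.

  Countable additivity is a continuity statement: if \<open>u\<^sub>k\<close> are supported in \<open>[n,n+1)\<close>, bounded by
  \<open>M\<close>, and \<open>\<integral>\<bar>u\<^sub>k\<bar>\<close> tends to zero, then so do the values of the functional (\<open>ext_tendsto_zero\<close>). Here a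
  Calderon--Zygmund decomposition at a single height \<open>h\<close> suffices. The bad part is a sum of multiples of
  atoms on disjoint dyadic intervals of total length at most \<open>h\<^sup>-\<^sup>1 \<integral>\<bar>u\<^sub>k\<bar>\<close>, hence has norm at most
  \<open>2 M h\<^sup>-\<^sup>1 \<integral>\<bar>u\<^sub>k\<bar>\<close>, which tends to zero for fixed \<open>h\<close>; the good part is bounded by \<open>2h\<close> and
  contributes at most a multiple of \<open>h\<close>, and \<open>h\<close> is arbitrary
  (\<open>Calderon_Zygmund_decomposition\<close>).

  Testing \<open>L\<close> on the atom built from the (conjugate) sign of \<open>\<phi> - \<phi>\<^sub>I\<close> bounds the oscillation on \<open>I\<close> by twice
  the norm of \<open>L\<close> (\<open>mean_osc_le_norm_dual\<close>), and evaluating \<open>L\<close> along atomic series gives the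
  reverse bound with constant 1 (\<open>norm_dual_le_norm_BMO\<close>).
\<close>

section \<open>Intervals, test functions and atoms\<close>

lemma bounded_interval_cases:
  assumes "bounded_interval I"
  obtains a b where "a < b" "{a<..<b} \<subseteq> I" "I \<subseteq> {a..b}"
    "I \<in> lmeasurable" "measure lebesgue I = b - a"
proof -
  have iv: "is_interval I" and bd: "bounded I" and pos: "0 < measure lebesgue I"
    using assms by (auto simp: bounded_interval_def)
  have meas: "I \<in> lmeasurable"
    using measurable_convex is_interval_convex_1 iv bd by blast
  have ne: "I \<noteq> {}" using pos by auto
  have ba: "bdd_above I" "bdd_below I"
    using bd by (auto intro: bounded_imp_bdd_above bounded_imp_bdd_below)
  let ?a = "Inf I" and ?b = "Sup I"
  have sub: "I \<subseteq> {?a..?b}"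
    using ba by (auto intro: cInf_lower cSup_upper)
  have sup: "{?a<..<?b} \<subseteq> I"
  proof
    fix x assume x: "x \<in> {?a<..<?b}"
    obtain y where "y \<in> I" "y < x" using x ne ba by (metis cInf_lessD greaterThanLessThan_iff)
    moreover obtain z where "z \<in> I" "x < z" using x ne ba by (metis less_cSupD greaterThanLessThan_iff)
    ultimately show "x \<in> I" using iv unfolding is_interval_1 by (meson less_imp_le)
  qed
  have le: "?a \<le> ?b" using ne ba by (meson cInf_le_cSup)
  have "measure lebesgue {?a<..<?b} \<le> measure lebesgue I"
    by (rule measure_mono_fmeasurable[OF sup _ meas]) auto
  moreover have "measure lebesgue I \<le> measure lebesgue {?a..?b}"
    by (rule measure_mono_fmeasurable[OF sub]) (use meas in \<open>auto simp: fmeasurableD\<close>)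
  ultimately have "measure lebesgue I = ?b - ?a" using le by auto
  with that[of ?a ?b] sub sup meas pos show ?thesis by auto
qed

lemma bounded_interval_lmeasurable: "bounded_interval I \<Longrightarrow> I \<in> lmeasurable"
  by (metis bounded_interval_cases)

lemma bounded_interval_Icc: "a < b \<Longrightarrow> bounded_interval {a..b}"
  by (auto simp: bounded_interval_def is_interval_cc)

lemma one_sided_Icc: "a < b \<Longrightarrow> 0 \<le> a \<or> b \<le> 0 \<Longrightarrow> {a..b} \<in> one_sided_intervals"
  by (auto simp: one_sided_intervals_def bounded_interval_Icc)

lemma one_sided_intervals_nonempty: "one_sided_intervals \<noteq> {}"
  using one_sided_Icc[of 0 1] by auto

lemma one_sided_bounded_interval: "I \<in> one_sided_intervals \<Longrightarrow> bounded_interval I"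
  by (auto simp: one_sided_intervals_def)

text \<open>Passing to the closed interval neither changes the length nor leaves the half-line.\<close>

lemma one_sided_subset_Icc:
  assumes "I \<in> one_sided_intervals"
  obtains a b where "a < b" "I \<subseteq> {a..b}" "measure lebesgue I = b - a" "0 \<le> a \<or> b \<le> 0"
proof -
  obtain a b where ab: "a < b" "{a<..<b} \<subseteq> I" "I \<subseteq> {a..b}" "measure lebesgue I = b - a"
    using bounded_interval_cases one_sided_bounded_interval[OF assms] by metis
  have "0 \<le> a \<or> b \<le> 0"
  proof (rule ccontr)
    assume n: "\<not> ?thesis"
    define x where "x = max a (-b) / 2"
    define y where "y = min b (-a) / 2"
    have "x \<in> I" "x < 0" using n ab by (auto simp: x_def subset_iff)
    moreover have "y \<in> I" "y > 0" using n ab by (auto simp: y_def subset_iff)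
    ultimately show False using assms by (auto simp: one_sided_intervals_def subset_iff)
  qed
  with that ab show ?thesis by blast
qed

text \<open>The class of test functions on which the functionals are compared: bounded, measurable, and
  vanishing outside a bounded set.\<close>

definition bounded_test :: "(real \<Rightarrow> 'a::{real_normed_field, euclidean_space}) \<Rightarrow> bool" where
  "bounded_test u \<longleftrightarrow> u \<in> borel_measurable lebesgue \<and> (\<exists>M. \<forall>x. norm (u x) \<le> M) \<and>
     (\<exists>N. \<forall>x. N < \<bar>x\<bar> \<longrightarrow> u x = 0)"

lemma integrable_bounded_support:
  fixes u :: "real \<Rightarrow> 'b::{banach, second_countable_topology}"
  assumes "u \<in> borel_measurable lebesgue" "\<And>x. norm (u x) \<le> M" "S \<in> lmeasurable"
    "\<And>x. x \<notin> S \<Longrightarrow> u x = 0"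
  shows "integrable lebesgue u"
    and "(LINT x|lebesgue. norm (u x)) \<le> M * measure lebesgue S"
proof -
  have i: "integrable lebesgue (\<lambda>x. M * indicat_real S x)"
    using assms(3) by (intro integrable_mult_right integrable_real_indicator) (auto simp: fmeasurable_def)
  have le: "norm (u x) \<le> M * indicat_real S x" for x
    using assms(2,4)[of x] by (auto simp: indicator_def)
  show iu: "integrable lebesgue u"
    by (rule Bochner_Integration.integrable_bound[OF i assms(1)])
      (use le in \<open>auto intro!: always_eventually order_trans[OF le]\<close>)
  have "(LINT x|lebesgue. norm (u x)) \<le> (LINT x|lebesgue. M * indicat_real S x)"
    by (intro integral_mono integrable_norm iu i le)
  also have "\<dots> = M * measure lebesgue S" using assms(3) by (simp add: fmeasurable_def)
  finally show "(LINT x|lebesgue. norm (u x)) \<le> M * measure lebesgue S" .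
qed

lemma bounded_test_integrable: "bounded_test u \<Longrightarrow> integrable lebesgue u"
  unfolding bounded_test_def
proof (elim conjE exE)
  fix M N assume *: "u \<in> borel_measurable lebesgue" "\<forall>x. norm (u x) \<le> M" "\<forall>x. N < \<bar>x\<bar> \<longrightarrow> u x = 0"
  show ?thesis
    by (rule integrable_bounded_support(1)[where S = "{-N..N}" and M = M]) (use * in auto)
qed

lemma bounded_test_mult_integrable:
  assumes "bounded_test u" "locally_integrable \<phi>"
  shows "integrable lebesgue (\<lambda>x. u x * \<phi> x)"
proof -
  obtain M N where u: "u \<in> borel_measurable lebesgue" "\<And>x. norm (u x) \<le> M"
      and N: "\<And>x. N < \<bar>x\<bar> \<Longrightarrow> u x = 0"
    using assms(1) unfolding bounded_test_def by metis
  have i: "integrable lebesgue (\<lambda>x. indicator {-N..N} x *\<^sub>R \<phi> x)"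
    using assms(2) unfolding locally_integrable_def set_integrable_def by blast
  have eq: "u x * \<phi> x = u x * (indicator {-N..N} x *\<^sub>R \<phi> x)" for x
    using N[of x] by (cases "x \<in> {-N..N}") auto
  show ?thesis
    unfolding eq
  proof (rule Bochner_Integration.integrable_bound[where f = "\<lambda>x. M * norm (indicator {-N..N} x *\<^sub>R \<phi> x)"])
    show "integrable lebesgue (\<lambda>x. M * norm (indicator {-N..N} x *\<^sub>R \<phi> x))"
      using i by (intro integrable_mult_right integrable_norm)
    show "(\<lambda>x. u x * (indicator {-N..N} x *\<^sub>R \<phi> x)) \<in> borel_measurable lebesgue"
      using u(1) borel_measurable_integrable[OF i] by (rule borel_measurable_times)
    have "norm (u x * (indicator {-N..N} x *\<^sub>R \<phi> x)) \<le> norm (M * norm (indicator {-N..N} x *\<^sub>R \<phi> x))" for x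
      using mult_right_mono[OF u(2)[of x] norm_ge_zero, of "indicator {-N..N} x *\<^sub>R \<phi> x"]
        order_trans[OF norm_ge_zero u(2)[of x]]
      by (simp add: norm_mult abs_mult del: norm_scaleR mult_scaleR_right)
    then show "AE x in lebesgue. norm (u x * (indicator {-N..N} x *\<^sub>R \<phi> x))
        \<le> norm (M * norm (indicator {-N..N} x *\<^sub>R \<phi> x))" by simp
  qed
qed

lemma supp_subset_closed:
  assumes "closed S" "\<And>x. x \<notin> S \<Longrightarrow> f x = 0"
  shows "supp f \<subseteq> S"
  unfolding supp_def by (rule closure_minimal) (use assms in auto)

lemma zero_outside_supp: "x \<notin> supp f \<Longrightarrow> f x = 0"
  unfolding supp_def using closure_subset[of "{x. f x \<noteq> 0}"] by blast

lemma bounded_test_if_supp: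
  assumes "bounded_compactly_supported u" "u \<in> borel_measurable lebesgue"
  shows "bounded_test u"
proof -
  obtain M where "\<forall>x. norm (u x) \<le> M"
    using assms(1) by (auto simp: bounded_compactly_supported_def bounded_iff)
  moreover have "bounded (supp u)"
    using compact_imp_bounded[of "supp u"] assms(1) by (simp add: bounded_compactly_supported_def)
  then obtain N where "\<forall>x\<in>supp u. \<bar>x\<bar> \<le> N" by (auto simp: bounded_iff)
  then have "\<forall>x. N < \<bar>x\<bar> \<longrightarrow> u x = 0" by (meson not_less zero_outside_supp)
  ultimately show ?thesis using assms(2) unfolding bounded_test_def by blast
qed

lemma
  assumes "atom_on I a"
  shows atom_zero_outside: "x \<notin> I \<Longrightarrow> a x = 0"
    and atom_bounded_test: "bounded_test a"
    and atom_integral: "(LINT x|lebesgue. a x) = 0"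
proof -
  have I: "bounded_interval I" and m: "a \<in> borel_measurable lebesgue"
    and b: "\<And>x. norm (a x) \<le> 1 / measure lebesgue I" and s: "supp a \<subseteq> I"
    and z: "(LINT x:I|lebesgue. a x) = 0"
    using assms by (auto simp: atom_on_def)
  show z0: "a x = 0" if "x \<notin> I" for x using that s zero_outside_supp by blast
  have "indicat_real I x *\<^sub>R a x = a x" for x using z0[of x] by (auto simp: indicator_def)
  then show "(LINT x|lebesgue. a x) = 0" using z by (simp add: set_lebesgue_integral_def)
  obtain N where "\<And>x. x \<in> I \<Longrightarrow> \<bar>x\<bar> \<le> N"
    using I by (auto simp: bounded_interval_def bounded_iff)
  then have "\<forall>x. N < \<bar>x\<bar> \<longrightarrow> a x = 0" using z0 not_less by blast
  then show "bounded_test a" using m b unfolding bounded_test_def by blast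
qed

lemma atom_on_zero: "bounded_interval I \<Longrightarrow> atom_on I (\<lambda>x. 0)"
  by (simp add: atom_on_def supp_def)

text \<open>Rescaling a bounded function of mean zero on a closed interval gives an atom. The case
  \<open>M = 0\<close> is harmless: then the function vanishes identically.\<close>

lemma atom_on_normalized:
  assumes "a < b" "u \<in> borel_measurable lebesgue" "\<And>x. norm (u x) \<le> M"
    "\<And>x. x \<notin> {a..b} \<Longrightarrow> u x = 0" "(LINT x|lebesgue. u x) = 0"
  shows "atom_on {a..b} (\<lambda>x. u x / of_real (M * (b - a)))"
proof -
  have M: "0 \<le> M" using assms(3) norm_ge_zero order_trans by blast
  have eq: "indicat_real {a..b} x *\<^sub>R (u x / of_real (M * (b - a))) = u x / of_real (M * (b - a))" for x
    using assms(4)[of x] by (auto simp: indicator_def)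
  have "norm (u x / of_real (M * (b - a))) \<le> 1 / (b - a)" for x
  proof (cases "M = 0")
    case False
    then have "norm (u x / of_real (M * (b - a))) = norm (u x) / (M * (b - a))"
      using M assms(1) by (simp add: norm_divide norm_mult flip: of_real_diff)
    also have "\<dots> \<le> M / (M * (b - a))"
      using M assms(1,3) by (intro divide_right_mono) auto
    finally show ?thesis using False by simp
  qed (use assms(1) in auto)
  moreover have "(LINT x:{a..b}|lebesgue. u x / of_real (M * (b - a))) = 0"
    unfolding set_lebesgue_integral_def eq using assms(5) by simp
  moreover have "supp (\<lambda>x. u x / of_real (M * (b - a))) \<subseteq> {a..b}"
    by (rule supp_subset_closed) (use assms(4) in auto)
  ultimately show ?thesis
    using assms(1,2) unfolding atom_on_def by (simp add: bounded_interval_Icc)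
qed

section \<open>Atomic decompositions\<close>

lemma norm_H1_2s_le:
  assumes "atomic_decomp_2s f c a"
  shows "norm_H1_2s f \<le> (\<Sum>j. norm (c j))"
  unfolding norm_H1_2s_def
proof (rule cInf_lower)
  show "bdd_below {\<Sum>j. norm (c j) |c a. atomic_decomp_2s f c a}"
    by (rule bdd_belowI[of _ 0]) (auto simp: atomic_decomp_2s_def intro!: suminf_nonneg)
qed (use assms in auto)

lemma norm_H1_2s_approx:
  assumes "f \<in> H1_2s" "norm_H1_2s f < r"
  obtains c a where "atomic_decomp_2s f c a" "(\<Sum>j. norm (c j)) < r"
proof -
  have "{\<Sum>j. norm (c j) |c a. atomic_decomp_2s f c a} \<noteq> {}"
    using assms(1) by (auto simp: H1_2s_def)
  from cInf_lessD[OF this assms(2)[unfolded norm_H1_2s_def]] that show ?thesis by blast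
qed

lemma norm_H1_2s_nonneg: "f \<in> H1_2s \<Longrightarrow> 0 \<le> norm_H1_2s f"
  unfolding norm_H1_2s_def
  by (rule cInf_greatest) (auto simp: H1_2s_def atomic_decomp_2s_def intro!: suminf_nonneg)

text \<open>A criterion for membership that does not mention atoms: \<open>M j * (q j - p j)\<close> is the coefficient
  of the normalized \<open>j\<close>-th term.\<close>

lemma H1_2s_seriesI:
  fixes f :: "real \<Rightarrow> 'a::{real_normed_field, euclidean_space}"
  assumes ab: "\<And>j. p j < q j" "\<And>j. 0 \<le> p j \<or> q j \<le> 0"
    and b: "\<And>j. b j \<in> borel_measurable lebesgue" "\<And>j x. norm (b j x) \<le> M j"
      "\<And>j x. x \<notin> {p j..q j} \<Longrightarrow> b j x = 0" "\<And>j. (LINT x|lebesgue. b j x) = 0"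
    and s: "summable (\<lambda>j. M j * (q j - p j))"
    and f: "integrable lebesgue f"
    and conv: "(\<lambda>n. LINT x|lebesgue. norm (f x - (\<Sum>j<n. b j x))) \<longlonglongrightarrow> 0"
  shows "f \<in> H1_2s" "norm_H1_2s f \<le> (\<Sum>j. M j * (q j - p j))"
proof -
  let ?c = "\<lambda>j. of_real (M j * (q j - p j)) :: 'a"
  let ?a = "\<lambda>j x. b j x / ?c j"
  have M: "0 \<le> M j" for j using b(2) norm_ge_zero order_trans by blast
  have nc: "norm (?c j) = M j * (q j - p j)" for j
    using M[of j] ab(1)[of j] by (simp add: norm_mult flip: of_real_diff)
  have eq: "?c j * ?a j x = b j x" for j x
  proof (cases "M j = 0")
    case True
    then show ?thesis using b(2)[of j x] by auto
  next
    case False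
    then have "?c j \<noteq> 0" using ab(1)[of j] by simp
    then show ?thesis by simp
  qed
  have "atom_on {p j..q j} (?a j)" for j
    by (rule atom_on_normalized) (use ab b in auto)
  then have "\<forall>j. \<exists>I\<in>one_sided_intervals. atom_on I (?a j)"
    using ab one_sided_Icc by blast
  then have "atomic_decomp_2s f ?c ?a"
    unfolding atomic_decomp_2s_def eq nc using s f conv by blast
  then show "f \<in> H1_2s" "norm_H1_2s f \<le> (\<Sum>j. M j * (q j - p j))"
    using norm_H1_2s_le[of f ?c ?a] unfolding nc H1_2s_def by auto
qed

lemma atomic_decomp_2s_finite:
  assumes "\<And>j. j < n \<Longrightarrow> \<exists>I\<in>one_sided_intervals. atom_on I (a j)"
  shows "atomic_decomp_2s (\<lambda>x. \<Sum>j<n. c j * a j x) (\<lambda>j. if j < n then c j else 0)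
           (\<lambda>j. if j < n then a j else (\<lambda>x. 0))"
proof -
  have "integrable lebesgue (\<lambda>x. c j * a j x)" if "j < n" for j
    using assms[OF that] atom_bounded_test bounded_test_integrable
    by (intro integrable_mult_right) blast
  then have "integrable lebesgue (\<lambda>x. \<Sum>j<n. c j * a j x)"
    by (intro Bochner_Integration.integrable_sum) auto
  moreover have "\<exists>I\<in>one_sided_intervals. atom_on I (if j < n then a j else (\<lambda>x. 0))" for j
    using assms[of j] one_sided_Icc[of 0 1] atom_on_zero[OF bounded_interval_Icc, of 0 1] by auto
  moreover have "summable (\<lambda>j. norm (if j < n then c j else 0))"
    by (rule summable_finite[of "{..<n}"]) auto
  moreover have "eventually (\<lambda>m. (LINT x|lebesgue. norm ((\<Sum>j<n. c j * a j x) -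
      (\<Sum>j<m. (if j < n then c j else 0) * (if j < n then a j else (\<lambda>x. 0)) x))) = 0) sequentially"
    using eventually_ge_at_top[of n]
  proof eventually_elim
    case (elim m)
    have "(\<Sum>j<m. (if j < n then c j else 0) * (if j < n then a j else (\<lambda>x. 0)) x) = (\<Sum>j<n. c j * a j x)" for x
      by (rule sum.mono_neutral_cong_right) (use elim in auto)
    then show ?case by simp
  qed
  then have "(\<lambda>m. LINT x|lebesgue. norm ((\<Sum>j<n. c j * a j x) -
      (\<Sum>j<m. (if j < n then c j else 0) * (if j < n then a j else (\<lambda>x. 0)) x))) \<longlonglongrightarrow> 0"
    by (rule tendsto_eventually)
  ultimately show ?thesis unfolding atomic_decomp_2s_def by blast
qed

lemma H1_2s_finite:
  fixes n :: nat
  assumes "\<And>j. j < n \<Longrightarrow> \<exists>I\<in>one_sided_intervals. atom_on I (a j)"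
  shows "(\<lambda>x. \<Sum>j<n. c j * a j x) \<in> H1_2s"
    and "norm_H1_2s (\<lambda>x. \<Sum>j<n. c j * a j x) \<le> (\<Sum>j<n. norm (c j))"
proof -
  note * = atomic_decomp_2s_finite[where n = n and a = a and c = c, OF assms]
  show "(\<lambda>x. \<Sum>j<n. c j * a j x) \<in> H1_2s" using * unfolding H1_2s_def by blast
  have "(\<Sum>j. norm (if j < n then c j else 0)) = (\<Sum>j<n. norm (c j))"
    by (subst suminf_finite[of "{..<n}"]) auto
  then show "norm_H1_2s (\<lambda>x. \<Sum>j<n. c j * a j x) \<le> (\<Sum>j<n. norm (c j))"
    using norm_H1_2s_le[OF *] by simp
qed

lemma H1_2s_atom:
  assumes "I \<in> one_sided_intervals" "atom_on I a"
  shows "a \<in> H1_2s" "norm_H1_2s a \<le> 1"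
proof -
  have "(\<lambda>x. \<Sum>j<(1::nat). (\<lambda>_. 1) j * (\<lambda>_. a) j x) \<in> H1_2s"
    by (rule H1_2s_finite) (use assms in auto)
  then show "a \<in> H1_2s" by simp
  have "norm_H1_2s (\<lambda>x. \<Sum>j<(1::nat). (\<lambda>_. 1) j * (\<lambda>_. a) j x) \<le> (\<Sum>j<(1::nat). norm ((\<lambda>_. 1::'a) j))"
    by (rule H1_2s_finite) (use assms in auto)
  then show "norm_H1_2s a \<le> 1" by simp
qed

lemma H1_2s_zero: "(\<lambda>x. 0) \<in> H1_2s" "norm_H1_2s (\<lambda>x. 0) \<le> 1"
  using H1_2s_atom[OF one_sided_Icc[of 0 1] atom_on_zero[OF bounded_interval_Icc]] by auto

lemma H1_2s_integrable: "f \<in> H1_2s \<Longrightarrow> integrable lebesgue f"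
  by (auto simp: H1_2s_def atomic_decomp_2s_def)

lemma atomic_decomp_2s_tail:
  assumes "atomic_decomp_2s f c a"
  shows "atomic_decomp_2s (\<lambda>x. f x - (\<Sum>j<n. c j * a j x)) (\<lambda>j. c (j + n)) (\<lambda>j. a (j + n))"
proof -
  have at: "\<forall>j. \<exists>I\<in>one_sided_intervals. atom_on I (a j)" and sc: "summable (\<lambda>j. norm (c j))"
    and f: "integrable lebesgue f"
    and lim: "(\<lambda>n. LINT x|lebesgue. norm (f x - (\<Sum>j<n. c j * a j x))) \<longlonglongrightarrow> 0"
    using assms by (auto simp: atomic_decomp_2s_def)
  have ia: "integrable lebesgue (a j)" for j
    using at atom_bounded_test bounded_test_integrable by blast
  have eq: "f x - (\<Sum>j<n. c j * a j x) - (\<Sum>j<k. c (j + n) * a (j + n) x) = f x - (\<Sum>j<k + n. c j * a j x)" for k x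
  proof -
    have "(\<Sum>j<k + n. c j * a j x) = (\<Sum>j<n. c j * a j x) + (\<Sum>j<k. c (j + n) * a (j + n) x)"
      by (induction k) (simp_all add: algebra_simps)
    then show ?thesis by simp
  qed
  have "(\<lambda>k. LINT x|lebesgue. norm (f x - (\<Sum>j<k + n. c j * a j x))) \<longlonglongrightarrow> 0"
    using lim by (rule LIMSEQ_ignore_initial_segment)
  moreover have "summable (\<lambda>j. norm (c (j + n)))" using sc by (rule summable_ignore_initial_segment)
  moreover have "integrable lebesgue (\<lambda>x. f x - (\<Sum>j<n. c j * a j x))" using f ia by simp
  ultimately show ?thesis unfolding atomic_decomp_2s_def eq using at by blast
qed

lemma tendsto_integral_mult_L1:
  fixes f :: "real \<Rightarrow> 'a::{real_normed_field, euclidean_space}"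
  assumes "integrable lebesgue f" "\<And>n::nat. integrable lebesgue (g n)"
    and conv: "(\<lambda>n. LINT x|lebesgue. norm (f x - g n x)) \<longlonglongrightarrow> 0"
    and w: "w \<in> borel_measurable lebesgue" "\<And>x. norm (w x) \<le> M"
  shows "(\<lambda>n. LINT x|lebesgue. g n x * w x) \<longlonglongrightarrow> (LINT x|lebesgue. f x * w x)"
proof -
  have M: "0 \<le> M" using w(2) norm_ge_zero order_trans by blast
  have im: "integrable lebesgue (\<lambda>x. h x * w x)" if "integrable lebesgue h" for h :: "real \<Rightarrow> 'a"
  proof (rule Bochner_Integration.integrable_bound[where f = "\<lambda>x. M * norm (h x)"])
    have "norm (h x * w x) \<le> norm (M * norm (h x))" for x
      using mult_right_mono[OF w(2) norm_ge_zero, of x "h x"] M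
      by (simp add: norm_mult abs_mult mult.commute)
    then show "AE x in lebesgue. norm (h x * w x) \<le> norm (M * norm (h x))" by simp
  qed (use that w(1) in \<open>auto intro: borel_measurable_times\<close>)
  have "norm ((LINT x|lebesgue. g n x * w x) - (LINT x|lebesgue. f x * w x))
      \<le> M * (LINT x|lebesgue. norm (f x - g n x))" for n
  proof -
    have "(LINT x|lebesgue. g n x * w x) - (LINT x|lebesgue. f x * w x)
        = (LINT x|lebesgue. g n x * w x - f x * w x)"
      using im assms(1,2) by simp
    also have "norm \<dots> \<le> (LINT x|lebesgue. norm (g n x * w x - f x * w x))"
      by (rule integral_norm_bound)
    also have "\<dots> \<le> (LINT x|lebesgue. M * norm (f x - g n x))"
    proof (rule integral_mono)
      fix x
      have "norm (g n x * w x - f x * w x) = norm (f x - g n x) * norm (w x)"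
        by (simp add: norm_mult[symmetric] left_diff_distrib norm_minus_commute)
      also have "\<dots> \<le> norm (f x - g n x) * M"
        by (rule mult_left_mono[OF w(2)]) simp
      finally show "norm (g n x * w x - f x * w x) \<le> M * norm (f x - g n x)"
        by (simp add: mult.commute)
    qed (use im assms in auto)
    finally show ?thesis by simp
  qed
  then have "(\<lambda>n. (LINT x|lebesgue. g n x * w x) - (LINT x|lebesgue. f x * w x)) \<longlonglongrightarrow> 0"
    by (rule Lim_null_comparison[OF always_eventually[OF allI]])
      (use tendsto_mult_left[OF conv, of M] in simp)
  then show ?thesis by (rule LIM_zero_cancel)
qed

text \<open>Against a bounded weight an atomic series may be integrated term by term.\<close>

lemma atomic_decomp_2s_sums:
  fixes f :: "real \<Rightarrow> 'a::{real_normed_field, euclidean_space}"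
  assumes "atomic_decomp_2s f c a" "w \<in> borel_measurable lebesgue" "\<And>x. norm (w x) \<le> M"
  shows "(\<lambda>j. c j * (LINT x|lebesgue. a j x * w x)) sums (LINT x|lebesgue. f x * w x)"
proof -
  have at: "\<exists>I. atom_on I (a j)" for j using assms(1) unfolding atomic_decomp_2s_def by blast
  then have bt: "bounded_test (a j)" for j using atom_bounded_test by blast
  have ia: "integrable lebesgue (\<lambda>x. a j x * w x)" for j
  proof (rule Bochner_Integration.integrable_bound[where f = "\<lambda>x. M * norm (a j x)"])
    have "norm (a j x * w x) \<le> norm (M * norm (a j x))" for x
      using mult_right_mono[OF assms(3) norm_ge_zero, of x "a j x"]
        order_trans[OF norm_ge_zero assms(3)]
      by (simp add: norm_mult abs_mult mult.commute)
    then show "AE x in lebesgue. norm (a j x * w x) \<le> norm (M * norm (a j x))" by simp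
  qed (use bounded_test_integrable[OF bt] assms(2) in \<open>auto intro: borel_measurable_times\<close>)
  have "(\<lambda>n. LINT x|lebesgue. (\<Sum>j<n. c j * a j x) * w x) \<longlonglongrightarrow> (LINT x|lebesgue. f x * w x)"
    by (rule tendsto_integral_mult_L1[OF _ _ _ assms(2,3)])
      (use assms(1) bounded_test_integrable[OF bt] in \<open>auto simp: atomic_decomp_2s_def\<close>)
  moreover have "(LINT x|lebesgue. (\<Sum>j<n. c j * a j x) * w x)
      = (\<Sum>j<n. c j * (LINT x|lebesgue. a j x * w x))" for n
    using ia by (simp add: sum_distrib_right mult.assoc)
  ultimately show ?thesis by (simp add: sums_def)
qed

text \<open>Elements of the space have mean zero on each side of the origin separately.\<close>

lemma H1_2s_half_line_integral:
  assumes f: "f \<in> H1_2s" and S: "S = {0..} \<or> S = {..<0}"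
  shows "(LINT x|lebesgue. f x * indicator S x) = 0"
proof -
  obtain c a where ca: "atomic_decomp_2s f c a" using f by (auto simp: H1_2s_def)
  have Sm: "S \<in> sets lebesgue" using S by auto
  have "(\<lambda>j. c j * (LINT x|lebesgue. a j x * indicator S x)) sums (LINT x|lebesgue. f x * indicator S x)"
    by (rule atomic_decomp_2s_sums[OF ca, where M = 1])
      (use Sm in \<open>auto simp: indicator_def\<close>)
  moreover have "(LINT x|lebesgue. a j x * indicator S x) = 0" for j
  proof -
    obtain I where I: "I \<in> one_sided_intervals" "atom_on I (a j)"
      using ca unfolding atomic_decomp_2s_def by blast
    have z: "a j x = 0" if "x \<notin> I" for x using atom_zero_outside I that by blast
    have side: "I \<subseteq> {..0} \<or> I \<subseteq> {0..}" using I by (auto simp: one_sided_intervals_def)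
    have ne0: "AE x in lebesgue. x \<noteq> (0::real)"
      by (rule AE_I'[of "{0}"]) auto
    have m: "a j \<in> borel_measurable lebesgue" using I by (simp add: atom_on_def)
    have mS: "(\<lambda>x. a j x * indicator S x) \<in> borel_measurable lebesgue"
      using m Sm by (intro borel_measurable_times borel_measurable_indicator)
    have "(LINT x|lebesgue. a j x * indicator S x) = 0 \<or>
       (LINT x|lebesgue. a j x * indicator S x) = (LINT x|lebesgue. a j x)"
    proof (cases "(S = {0..}) = (I \<subseteq> {0..})")
      case True
      have "AE x in lebesgue. a j x * indicator S x = a j x"
        using ne0
      proof eventually_elim
        case (elim x)
        then show ?case using True side S z[of x]
          by (cases "x \<in> I") (auto simp: indicator_def subset_iff)
      qed
      then show ?thesis by (intro disjI2 integral_cong_AE[OF mS m])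
    next
      case False
      have "{0..} \<noteq> {..<0::real}" by (simp add: set_eq_iff) (use zero_less_one in blast)
      then have "I \<inter> S \<subseteq> {0}" using S
      proof (elim disjE)
        assume "S = {0..}"
        then have "I \<subseteq> {..0}" using False side by simp
        then show ?thesis using \<open>S = {0..}\<close> by auto
      next
        assume "S = {..<0}"
        then have "I \<subseteq> {0..}" using False \<open>{0..} \<noteq> {..<0::real}\<close> by metis
        then show ?thesis using \<open>S = {..<0}\<close> by auto
      qed
      have "AE x in lebesgue. a j x * indicator S x = 0"
        using ne0
      proof eventually_elim
        case (elim x)
        then have "x \<notin> I \<or> x \<notin> S" using \<open>I \<inter> S \<subseteq> {0}\<close> by blast
        then show ?case using z[of x] by (auto simp: indicator_def)
      qed
      then show ?thesis by (intro disjI1 integral_eq_zero_AE)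
    qed
    then show ?thesis using atom_integral[OF I(2)] by auto
  qed
  ultimately show ?thesis by (simp add: sums_iff)
qed

section \<open>Pairing atoms with functions of bounded mean oscillation\<close>

lemma locally_integrable_measurable:
  assumes "locally_integrable \<phi>"
  shows "\<phi> \<in> borel_measurable lebesgue"
proof (rule borel_measurable_LIMSEQ_metric)
  show "(\<lambda>x. indicat_real {- real N..real N} x *\<^sub>R \<phi> x) \<in> borel_measurable lebesgue" for N
    using assms unfolding locally_integrable_def set_integrable_def
    by (intro borel_measurable_integrable) blast
  show "(\<lambda>N. indicat_real {- real N..real N} x *\<^sub>R \<phi> x) \<longlonglongrightarrow> \<phi> x" for x
  proof (rule tendsto_eventually)
    show "eventually (\<lambda>N. indicat_real {- real N..real N} x *\<^sub>R \<phi> x = \<phi> x) sequentially"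
      using eventually_ge_at_top[of "nat \<lceil>\<bar>x\<bar>\<rceil>"]
    proof eventually_elim
      case (elim N)
      then have "x \<in> {- real N..real N}" by (auto simp: nat_le_iff ceiling_le_iff)
      then show ?case by simp
    qed
  qed
qed

lemma locally_integrable_bounded:
  assumes "\<psi> \<in> borel_measurable lebesgue" "\<And>x. norm (\<psi> x) \<le> M"
  shows "locally_integrable \<psi>"
  unfolding locally_integrable_def set_integrable_def
proof (intro allI impI)
  fix K :: "real set" assume "compact K"
  then have K: "K \<in> lmeasurable" by (rule lmeasurable_compact)
  show "integrable lebesgue (\<lambda>x. indicat_real K x *\<^sub>R \<psi> x)"
    by (rule integrable_bounded_support(1)[where S = K and M = "\<bar>M\<bar>"])
      (use K assms(1) order_trans[OF assms(2) abs_ge_self]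
        in \<open>auto simp: indicator_def intro!: borel_measurable_scaleR borel_measurable_indicator fmeasurableD\<close>)
qed

lemma locally_integrable_on_interval:
  assumes "locally_integrable \<phi>" "bounded_interval I"
  shows "integrable lebesgue (\<lambda>x. indicat_real I x *\<^sub>R \<phi> x)"
proof -
  obtain a b where I: "I \<subseteq> {a..b}" "I \<in> lmeasurable"
    using bounded_interval_cases[OF assms(2)] by metis
  have "integrable lebesgue (\<lambda>x. indicat_real {a..b} x *\<^sub>R \<phi> x)"
    using assms(1) unfolding locally_integrable_def set_integrable_def by blast
  note i = integrable_mult_indicator[OF fmeasurableD[OF I(2)] this]
  have eq: "indicat_real I x *\<^sub>R indicat_real {a..b} x *\<^sub>R \<phi> x = indicat_real I x *\<^sub>R \<phi> x" for x
    using I by (cases "x \<in> I") auto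
  from i
  show ?thesis unfolding eq .
qed

lemma integrable_oscillation:
  assumes "locally_integrable \<phi>" "bounded_interval I"
  shows "integrable lebesgue (\<lambda>x. indicat_real I x * norm (\<phi> x - m))"
proof -
  have "integrable lebesgue (\<lambda>x. indicat_real I x *\<^sub>R m)"
    using bounded_interval_lmeasurable[OF assms(2)]
    by (intro integrable_scaleR_left integrable_real_indicator) (auto simp: fmeasurable_def)
  with locally_integrable_on_interval[OF assms]
  have "integrable lebesgue (\<lambda>x. indicat_real I x *\<^sub>R \<phi> x - indicat_real I x *\<^sub>R m)" by simp
  from integrable_norm[OF this]
  show ?thesis unfolding scaleR_diff_right[symmetric] norm_scaleR by simp
qed

lemma mean_osc_nonneg: "0 \<le> mean_osc I \<phi>"
  unfolding mean_osc_def set_lebesgue_integral_def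
  by (intro mult_nonneg_nonneg integral_nonneg_AE) auto

lemma mean_osc_le_norm:
  "\<phi> \<in> BMO_2s \<Longrightarrow> I \<in> one_sided_intervals \<Longrightarrow> mean_osc I \<phi> \<le> norm_BMO_2s \<phi>"
  unfolding norm_BMO_2s_def BMO_2s_def by (auto intro: cSUP_upper)

lemma norm_BMO_2s_nonneg: "\<phi> \<in> BMO_2s \<Longrightarrow> 0 \<le> norm_BMO_2s \<phi>"
  using mean_osc_le_norm mean_osc_nonneg one_sided_intervals_nonempty by (meson ex_in_conv order_trans)

text \<open>Since the atom has mean zero, a constant may be subtracted from the other factor. Composing with
  a contraction \<open>T\<close> covers both \<open>\<phi>\<close> and its truncations.\<close>

lemma atom_pairing_le:
  fixes \<phi> :: "real \<Rightarrow> 'a::{real_normed_field, euclidean_space}"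
  assumes \<phi>: "\<phi> \<in> BMO_2s" and I: "I \<in> one_sided_intervals" and a: "atom_on I a"
    and T: "\<And>y z. norm (T y - T z) \<le> norm (y - z)" and li: "locally_integrable (\<lambda>x. T (\<phi> x))"
  shows "norm (LINT x|lebesgue. a x * T (\<phi> x)) \<le> norm_BMO_2s \<phi>"
proof -
  have l\<phi>: "locally_integrable \<phi>" using \<phi> by (simp add: BMO_2s_def)
  have bI: "bounded_interval I" using one_sided_bounded_interval I .
  let ?m = "mean_on I \<phi>" and ?l = "measure lebesgue I"
  have bt: "bounded_test a" using atom_bounded_test a .
  have i1: "integrable lebesgue (\<lambda>x. a x * T (\<phi> x))" by (rule bounded_test_mult_integrable[OF bt li])
  have i2: "integrable lebesgue (\<lambda>x. a x * T ?m)" using bounded_test_integrable[OF bt] by simp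
  have i3: "integrable lebesgue (\<lambda>x. 1 / ?l * (indicat_real I x * norm (\<phi> x - ?m)))"
    by (intro integrable_mult_right integrable_oscillation l\<phi> bI)
  have "(LINT x|lebesgue. a x * T (\<phi> x)) = (LINT x|lebesgue. a x * T (\<phi> x) - a x * T ?m)"
    using i1 i2 atom_integral[OF a] by simp
  also have "norm \<dots> \<le> (LINT x|lebesgue. norm (a x * T (\<phi> x) - a x * T ?m))"
    by (rule integral_norm_bound)
  also have "\<dots> \<le> (LINT x|lebesgue. 1 / ?l * (indicat_real I x * norm (\<phi> x - ?m)))"
  proof (rule integral_mono)
    fix x
    have ax: "norm (a x) \<le> 1 / ?l" using a by (simp add: atom_on_def)
    have "norm (a x * T (\<phi> x) - a x * T ?m) = norm (a x) * norm (T (\<phi> x) - T ?m)"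
      by (simp add: norm_mult right_diff_distrib[symmetric])
    also have "\<dots> \<le> 1 / ?l * (indicat_real I x * norm (\<phi> x - ?m))"
    proof (cases "x \<in> I")
      case True
      then show ?thesis using mult_mono[OF ax T[of "\<phi> x" ?m]] by simp
    next
      case False
      then show ?thesis using atom_zero_outside[OF a False] by simp
    qed
    finally show "norm (a x * T (\<phi> x) - a x * T ?m) \<le> 1 / ?l * (indicat_real I x * norm (\<phi> x - ?m))" .
  qed (use i1 i2 i3 in auto)
  also have "\<dots> = mean_osc I \<phi>"
    by (simp add: mean_osc_def set_lebesgue_integral_def)
  also have "\<dots> \<le> norm_BMO_2s \<phi>" by (rule mean_osc_le_norm[OF \<phi> I])
  finally show ?thesis .
qed

lemma L_functional_atom_le:
  assumes "\<phi> \<in> BMO_2s" "I \<in> one_sided_intervals" "atom_on I a"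
  shows "norm (L_functional \<phi> a) \<le> norm_BMO_2s \<phi>"
  using atom_pairing_le[OF assms, of "\<lambda>y. y"] assms(1)
  by (simp add: L_functional_def BMO_2s_def)

section \<open>The functional induced by a function of bounded mean oscillation\<close>

text \<open>Truncation at height \<open>N\<close>: the nearest-point projection onto the ball of radius \<open>N\<close>, which is a
  contraction.\<close>

definition truncation :: "nat \<Rightarrow> 'a::{real_normed_field, euclidean_space} \<Rightarrow> 'a" where
  "truncation N = closest_point (cball 0 (real N))"

lemma truncation_contraction: "norm (truncation N y - truncation N z) \<le> norm (y - z)"
  using closest_point_lipschitz[of "cball 0 (real N)" y z]
  by (simp add: truncation_def dist_norm)

lemma norm_truncation: "norm (truncation N y) \<le> real N" "norm (truncation N y) \<le> norm y"
proof -
  have "truncation N y \<in> cball 0 (real N)"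
    unfolding truncation_def by (rule closest_point_in_set) auto
  then show "norm (truncation N y) \<le> real N" by simp
  have "truncation N 0 = (0::'a)" unfolding truncation_def by (rule closest_point_self) simp
  then show "norm (truncation N y) \<le> norm y" using truncation_contraction[of N y 0] by simp
qed

lemma truncation_self: "norm y \<le> real N \<Longrightarrow> truncation N y = y"
  unfolding truncation_def by (rule closest_point_self) simp

lemma truncation_measurable:
  assumes "\<phi> \<in> borel_measurable lebesgue"
  shows "(\<lambda>x. truncation N (\<phi> x)) \<in> borel_measurable lebesgue"
proof -
  have "continuous_on UNIV (truncation N)"
    unfolding truncation_def by (rule continuous_on_closest_point) auto
  then have "truncation N \<in> borel_measurable borel" by (rule borel_measurable_continuous_onI)
  then show ?thesis using assms by (rule measurable_compose_rev)
qed

lemma truncation_pairing_tendsto: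
  fixes u :: "real \<Rightarrow> 'a::{real_normed_field, euclidean_space}"
  assumes "bounded_test u" "locally_integrable \<phi>"
  shows "(\<lambda>N. LINT x|lebesgue. u x * truncation N (\<phi> x)) \<longlonglongrightarrow> L_functional \<phi> u"
  unfolding L_functional_def
proof (rule integral_dominated_convergence[where w = "\<lambda>x. norm (u x * \<phi> x)"])
  have um: "u \<in> borel_measurable lebesgue" using assms(1) by (simp add: bounded_test_def)
  have i: "integrable lebesgue (\<lambda>x. u x * \<phi> x)" by (rule bounded_test_mult_integrable[OF assms])
  show "(\<lambda>x. u x * \<phi> x) \<in> borel_measurable lebesgue" using i by auto
  show "integrable lebesgue (\<lambda>x. norm (u x * \<phi> x))" using i by (rule integrable_norm)
  show "(\<lambda>x. u x * truncation N (\<phi> x)) \<in> borel_measurable lebesgue" for N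
    using um truncation_measurable[OF locally_integrable_measurable[OF assms(2)]]
    by (rule borel_measurable_times)
  show "AE x in lebesgue. norm (u x * truncation N (\<phi> x)) \<le> norm (u x * \<phi> x)" for N
    by (simp add: norm_mult mult_left_mono norm_truncation(2))
  have "(\<lambda>N. u x * truncation N (\<phi> x)) \<longlonglongrightarrow> u x * \<phi> x" for x
  proof (rule tendsto_eventually)
    show "eventually (\<lambda>N. u x * truncation N (\<phi> x) = u x * \<phi> x) sequentially"
      using eventually_ge_at_top[of "nat \<lceil>norm (\<phi> x)\<rceil>"]
    proof eventually_elim
      case (elim N)
      then have "norm (\<phi> x) \<le> real N" by (simp add: nat_le_iff ceiling_le_iff)
      then show ?case by (simp add: truncation_self)
    qed
  qed
  then show "AE x in lebesgue. (\<lambda>N. u x * truncation N (\<phi> x)) \<longlonglongrightarrow> u x * \<phi> x" by simp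
qed

text \<open>Truncating \<open>\<phi>\<close> makes it bounded, so that an atomic series may be integrated against it term by
  term; the terms are dominated uniformly in \<open>N\<close>. The limit therefore does not depend on
  the decomposition.\<close>

lemma truncation_pairing_sums:
  fixes f :: "real \<Rightarrow> 'a::{real_normed_field, euclidean_space}"
  assumes \<phi>: "\<phi> \<in> BMO_2s" and d: "atomic_decomp_2s f c a"
  shows "(\<lambda>N. LINT x|lebesgue. f x * truncation N (\<phi> x)) \<longlonglongrightarrow> (\<Sum>j. c j * L_functional \<phi> (a j))"
    and "norm (\<Sum>j. c j * L_functional \<phi> (a j)) \<le> norm_BMO_2s \<phi> * (\<Sum>j. norm (c j))"
proof -
  let ?B = "norm_BMO_2s \<phi>"
  have l\<phi>: "locally_integrable \<phi>" using \<phi> by (simp add: BMO_2s_def)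
  have m: "(\<lambda>x. truncation N (\<phi> x)) \<in> borel_measurable lebesgue" for N
    by (rule truncation_measurable[OF locally_integrable_measurable[OF l\<phi>]])
  have at: "\<exists>I\<in>one_sided_intervals. atom_on I (a j)" for j using d unfolding atomic_decomp_2s_def by blast
  then have bt: "bounded_test (a j)" for j using atom_bounded_test by blast
  have sc: "summable (\<lambda>j. norm (c j))" using d by (simp add: atomic_decomp_2s_def)
  let ?t = "\<lambda>j N. LINT x|lebesgue. a j x * truncation N (\<phi> x)"
  have tB: "norm (?t j N) \<le> ?B" for j N
  proof -
    obtain I where "I \<in> one_sided_intervals" "atom_on I (a j)" using at by blast
    then show ?thesis
      by (rule atom_pairing_le[OF \<phi> _ _ truncation_contraction locally_integrable_bounded[OF m norm_truncation(1)]])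
  qed
  have "(\<lambda>N. \<Sum>j. c j * ?t j N) \<longlonglongrightarrow> (\<Sum>j. c j * L_functional \<phi> (a j))"
  proof -
    have 1: "((\<lambda>N. c j * ?t j N) \<longlongrightarrow> c j * L_functional \<phi> (a j)) sequentially" for j
      by (intro tendsto_mult_left truncation_pairing_tendsto bt l\<phi>)
    have 2: "norm (c j * ?t j N) \<le> norm (c j) * ?B" for j N
      unfolding norm_mult by (rule mult_left_mono[OF tB norm_ge_zero])
    have 3: "summable (\<lambda>j. norm (c j) * ?B)" by (rule summable_mult2[OF sc])
    have "eventually (\<lambda>(j, N). norm (c j * ?t j N) \<le> norm (c j) * ?B) (sequentially \<times>\<^sub>F sequentially)"
      by (rule always_eventually) (use 2 in auto)
    from tannerys_theorem[OF 1 this 3] show ?thesis by simp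
  qed
  moreover have "(\<Sum>j. c j * ?t j N) = (LINT x|lebesgue. f x * truncation N (\<phi> x))" for N
    using atomic_decomp_2s_sums[OF d m norm_truncation(1)] by (simp add: sums_iff)
  ultimately show "(\<lambda>N. LINT x|lebesgue. f x * truncation N (\<phi> x)) \<longlonglongrightarrow> (\<Sum>j. c j * L_functional \<phi> (a j))"
    by simp
  have LB: "norm (c j * L_functional \<phi> (a j)) \<le> ?B * norm (c j)" for j
  proof -
    obtain I where "I \<in> one_sided_intervals" "atom_on I (a j)" using at by blast
    from L_functional_atom_le[OF \<phi> this] show ?thesis
      using mult_left_mono[of _ _ "norm (c j)"] by (fastforce simp: norm_mult mult.commute)
  qed
  have s: "summable (\<lambda>j. ?B * norm (c j))" by (rule summable_mult[OF sc])
  have sL: "summable (\<lambda>j. norm (c j * L_functional \<phi> (a j)))"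
    by (rule summable_comparison_test'[OF s]) (use LB in simp)
  have "norm (\<Sum>j. c j * L_functional \<phi> (a j)) \<le> (\<Sum>j. norm (c j * L_functional \<phi> (a j)))"
    by (rule summable_norm[OF sL])
  also have "\<dots> \<le> (\<Sum>j. ?B * norm (c j))" by (rule suminf_le[OF LB sL s])
  also have "\<dots> = ?B * (\<Sum>j. norm (c j))" by (rule suminf_mult[OF sc])
  finally show "norm (\<Sum>j. c j * L_functional \<phi> (a j)) \<le> ?B * (\<Sum>j. norm (c j))" .
qed

text \<open>The extension to the whole space is defined by the limit itself. Additivity is then immediate, and
  no choice of a decomposition is involved.\<close>

definition BMO_functional :: "(real \<Rightarrow> 'a::{real_normed_field, euclidean_space}) \<Rightarrow> (real \<Rightarrow> 'a) \<Rightarrow> 'a" where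
  "BMO_functional \<phi> f = lim (\<lambda>N. LINT x|lebesgue. f x * truncation N (\<phi> x))"

lemma BMO_functional_tendsto:
  assumes "\<phi> \<in> BMO_2s" "f \<in> H1_2s"
  shows "(\<lambda>N. LINT x|lebesgue. f x * truncation N (\<phi> x)) \<longlonglongrightarrow> BMO_functional \<phi> f"
proof -
  obtain c a where "atomic_decomp_2s f c a" using assms(2) by (auto simp: H1_2s_def)
  from truncation_pairing_sums(1)[OF assms(1) this] show ?thesis
    unfolding BMO_functional_def by (simp add: limI)
qed

text \<open>An estimate by the coefficients of every decomposition passes to the infimum.\<close>

lemma le_mult_norm_H1_2s:
  assumes f: "f \<in> H1_2s" and B: "0 \<le> B"
    and le: "\<And>c a. atomic_decomp_2s f c a \<Longrightarrow> r \<le> B * (\<Sum>j. norm (c j))"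
  shows "r \<le> B * norm_H1_2s f"
proof (rule field_le_epsilon)
  fix e :: real assume e: "0 < e"
  define d where "d = e / (B + 1)"
  have d: "0 < d" "B * d \<le> e" using e B by (auto simp: d_def field_simps)
  obtain c a where ca: "atomic_decomp_2s f c a" "(\<Sum>j. norm (c j)) < norm_H1_2s f + d"
    using norm_H1_2s_approx[OF f, of "norm_H1_2s f + d"] d by auto
  have "r \<le> B * (norm_H1_2s f + d)"
    using le[OF ca(1)] mult_left_mono[OF less_imp_le[OF ca(2)] B] by linarith
  then show "r \<le> B * norm_H1_2s f + e" using d by (simp add: distrib_left)
qed

lemma norm_BMO_functional_le:
  assumes "\<phi> \<in> BMO_2s" "f \<in> H1_2s"
  shows "norm (BMO_functional \<phi> f) \<le> norm_BMO_2s \<phi> * norm_H1_2s f"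
proof (rule le_mult_norm_H1_2s[OF assms(2) norm_BMO_2s_nonneg[OF assms(1)]])
  fix c a assume d: "atomic_decomp_2s f c a"
  have "BMO_functional \<phi> f = (\<Sum>j. c j * L_functional \<phi> (a j))"
    using truncation_pairing_sums(1)[OF assms(1) d] BMO_functional_tendsto[OF assms] LIMSEQ_unique by blast
  then show "norm (BMO_functional \<phi> f) \<le> norm_BMO_2s \<phi> * (\<Sum>j. norm (c j))"
    using truncation_pairing_sums(2)[OF assms(1) d] by simp
qed

lemma norm_dual_H1_2s_leI:
  fixes L :: "(real \<Rightarrow> 'a::{real_normed_field, euclidean_space}) \<Rightarrow> 'a"
  assumes "0 \<le> B" "\<And>f. f \<in> H1_2s \<Longrightarrow> norm (L f) \<le> B * norm_H1_2s f"
  shows "norm_dual_H1_2s L \<le> B"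
  unfolding norm_dual_H1_2s_def
proof (rule cSUP_least)
  show "{f :: real \<Rightarrow> 'a. f \<in> H1_2s \<and> norm_H1_2s f \<le> 1} \<noteq> {}" using H1_2s_zero by blast
  fix f :: "real \<Rightarrow> 'a" assume f: "f \<in> {f \<in> H1_2s. norm_H1_2s f \<le> 1}"
  then have "norm (L f) \<le> B * norm_H1_2s f" using assms(2) by blast
  also have "\<dots> \<le> B * 1" by (rule mult_left_mono) (use f assms(1) in auto)
  finally show "norm (L f) \<le> B" by simp
qed

lemma BMO_functional_dual:
  fixes \<phi> :: "real \<Rightarrow> 'a::{real_normed_field, euclidean_space}"
  assumes \<phi>: "\<phi> \<in> BMO_2s"
  shows "BMO_functional \<phi> \<in> dual_H1_2s"
proof -
  have l\<phi>: "locally_integrable \<phi>" using \<phi> by (simp add: BMO_2s_def)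
  have i: "integrable lebesgue (\<lambda>x. f x * truncation N (\<phi> x))" if "f \<in> H1_2s" for f N
  proof (rule Bochner_Integration.integrable_bound[where f = "\<lambda>x. real N * norm (f x)"])
    show "integrable lebesgue (\<lambda>x. real N * norm (f x))"
      using H1_2s_integrable[OF that] by (intro integrable_mult_right integrable_norm)
    show "(\<lambda>x. f x * truncation N (\<phi> x)) \<in> borel_measurable lebesgue"
      using H1_2s_integrable[OF that] truncation_measurable[OF locally_integrable_measurable[OF l\<phi>]]
      by (intro borel_measurable_times) auto
    have "norm (f x * truncation N (\<phi> x)) \<le> norm (real N * norm (f x))" for x
      using mult_left_mono[OF norm_truncation(1)[of N "\<phi> x"] norm_ge_zero[of "f x"]]
      by (simp add: norm_mult mult.commute)
    then show "AE x in lebesgue. norm (f x * truncation N (\<phi> x)) \<le> norm (real N * norm (f x))" by simp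
  qed
  have "BMO_functional \<phi> (\<lambda>x. f x + g x) = BMO_functional \<phi> f + BMO_functional \<phi> g"
    if f: "f \<in> H1_2s" and g: "g \<in> H1_2s" for f g
  proof -
    have "(\<lambda>N. LINT x|lebesgue. (f x + g x) * truncation N (\<phi> x)) \<longlonglongrightarrow> BMO_functional \<phi> f + BMO_functional \<phi> g"
      using tendsto_add[OF BMO_functional_tendsto[OF \<phi> f] BMO_functional_tendsto[OF \<phi> g]] i f g
      by (simp add: distrib_right)
    then show ?thesis unfolding BMO_functional_def[of \<phi> "\<lambda>x. f x + g x"] by (rule limI)
  qed
  moreover have "BMO_functional \<phi> (\<lambda>x. k * f x) = k * BMO_functional \<phi> f" if f: "f \<in> H1_2s" for k f
  proof -
    have "(\<lambda>N. LINT x|lebesgue. k * f x * truncation N (\<phi> x)) \<longlonglongrightarrow> k * BMO_functional \<phi> f"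
      using tendsto_mult_left[OF BMO_functional_tendsto[OF \<phi> f], of k] by (simp add: mult.assoc)
    then show ?thesis unfolding BMO_functional_def[of \<phi> "\<lambda>x. k * f x"] by (rule limI)
  qed
  ultimately show ?thesis
    using norm_BMO_functional_le[OF \<phi>] unfolding dual_H1_2s_def by blast
qed

lemma BMO_functional_eq:
  assumes \<phi>: "\<phi> \<in> BMO_2s" and f: "f \<in> H1_2s" "bounded_compactly_supported f"
  shows "BMO_functional \<phi> f = L_functional \<phi> f"
proof -
  have "bounded_test f"
    by (rule bounded_test_if_supp[OF f(2) borel_measurable_integrable[OF H1_2s_integrable[OF f(1)]]])
  then have "(\<lambda>N. LINT x|lebesgue. f x * truncation N (\<phi> x)) \<longlonglongrightarrow> L_functional \<phi> f"
    using \<phi> by (intro truncation_pairing_tendsto) (auto simp: BMO_2s_def)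
  then show ?thesis using BMO_functional_tendsto[OF \<phi> f(1)] LIMSEQ_unique by blast
qed

section \<open>Calderon--Zygmund decomposition at one height\<close>

text \<open>The half-open dyadic intervals of length \<open>2\<^sup>-\<^sup>k\<close>. At each level \<open>k\<close> they partition the line, and the
  cell of level \<open>k\<close> containing \<open>x\<close> has the index \<open>\<lfloor>2\<^sup>k x\<rfloor>\<close>; the index of an ancestor is obtained by
  integer division, rounding towards minus infinity.\<close>

definition dyadic :: "nat \<Rightarrow> int \<Rightarrow> real set" where
  "dyadic k j = {of_int j / 2 ^ k..<(of_int j + 1) / 2 ^ k}"

lemma mem_dyadic: "x \<in> dyadic k j \<longleftrightarrow> \<lfloor>2 ^ k * x\<rfloor> = j"
  by (auto simp: dyadic_def floor_eq_iff field_simps)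

lemma dyadic_subset_ancestor:
  assumes "k' \<le> k"
  shows "dyadic k j \<subseteq> dyadic k' (j div 2 ^ (k - k'))"
proof
  fix x assume "x \<in> dyadic k j"
  then have j: "\<lfloor>2 ^ k * x\<rfloor> = j" by (simp add: mem_dyadic)
  have "(2::real) ^ k = 2 ^ k' * 2 ^ (k - k')"
    using assms by (simp add: power_add[symmetric])
  then have "2 ^ k' * x = (2 ^ k * x) / real_of_int (2 ^ (k - k'))"
    by simp
  also have "\<lfloor>\<dots>\<rfloor> = \<lfloor>2 ^ k * x\<rfloor> div 2 ^ (k - k')"
    by (rule floor_divide_real_eq_div) simp
  finally show "x \<in> dyadic k' (j div 2 ^ (k - k'))" using j by (simp add: mem_dyadic)
qed

lemma dyadic_sets [simp]: "dyadic k j \<in> sets lebesgue"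
  by (simp add: dyadic_def)

lemma emeasure_dyadic: "emeasure lebesgue (dyadic k j) = ennreal (1 / 2 ^ k)"
  by (simp add: dyadic_def diff_divide_distrib[symmetric] divide_right_mono)

text \<open>Any family of dyadic cells can be replaced by its maximal members, which are disjoint and have
  the same union. They are listed as a sequence, padded with empty sets.\<close>

lemma maximal_dyadic:
  fixes P :: "nat \<Rightarrow> int \<Rightarrow> bool"
  shows "\<exists>X :: nat \<Rightarrow> real set. disjoint_family X \<and> (\<forall>i. X i \<in> sets lebesgue) \<and>
    (\<forall>i. X i \<noteq> {} \<longrightarrow> (\<exists>k j. X i = dyadic k j \<and> P k j \<and> (\<forall>k'<k. \<not> P k' (j div 2 ^ (k - k'))))) \<and>
    (\<forall>k j. P k j \<longrightarrow> dyadic k j \<subseteq> (\<Union>i. X i))"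
proof -
  define sel where "sel k j \<longleftrightarrow> P k j \<and> (\<forall>k'<k. \<not> P k' (j div 2 ^ (k - k')))" for k j
  define K where "K i = fst (prod_decode i)" for i
  define J where "J i = int_decode (snd (prod_decode i))" for i
  define X where "X i = (if sel (K i) (J i) then dyadic (K i) (J i) else {})" for i
  have KJ: "K (prod_encode (k, int_encode j)) = k" "J (prod_encode (k, int_encode j)) = j" for k j
    by (simp_all add: K_def J_def)
  have inj: "i = i'" if "K i = K i'" "J i = J i'" for i i'
    using that unfolding K_def J_def
    by (metis int_decode_inverse prod.collapse prod_decode_inverse)
  have lt: False if "x \<in> dyadic k j" "x \<in> dyadic k' j'" "sel k j" "sel k' j'" "k' < k" for x k k' j j'
  proof -
    have "x \<in> dyadic k' (j div 2 ^ (k - k'))"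
      using dyadic_subset_ancestor[of k' k j] that by auto
    then have "j' = j div 2 ^ (k - k')" using that(2) by (simp add: mem_dyadic)
    then show False using that by (auto simp: sel_def)
  qed
  have "disjoint_family X"
  proof (rule ccontr)
    assume "\<not> ?thesis"
    then obtain i i' x where i: "i \<noteq> i'" "x \<in> X i" "x \<in> X i'"
      unfolding disjoint_family_on_def by blast
    then have s: "sel (K i) (J i)" "sel (K i') (J i')" "x \<in> dyadic (K i) (J i)" "x \<in> dyadic (K i') (J i')"
      by (auto simp: X_def split: if_splits)
    then have "K i = K i'" using lt by (metis linorder_neqE_nat)
    moreover from this have "J i = J i'" using s(3,4) by (simp add: mem_dyadic)
    ultimately show False using inj i(1) by blast
  qed
  moreover have "\<exists>k j. X i = dyadic k j \<and> P k j \<and> (\<forall>k'<k. \<not> P k' (j div 2 ^ (k - k')))" if "X i \<noteq> {}" for i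
    using that unfolding X_def sel_def by (auto split: if_splits)
  moreover have "dyadic k j \<subseteq> (\<Union>i. X i)" if P: "P k j" for k j
  proof
    fix x assume x: "x \<in> dyadic k j"
    let ?R = "\<lambda>k. P k \<lfloor>2 ^ k * x\<rfloor>"
    define l where "l = (LEAST k. ?R k)"
    have "?R k" using x P by (simp add: mem_dyadic)
    then have Rl: "?R l" unfolding l_def by (rule LeastI)
    have nl: "\<not> ?R k'" if "k' < l" for k' using that unfolding l_def by (rule not_less_Least)
    have anc: "\<lfloor>2 ^ k' * x\<rfloor> = \<lfloor>2 ^ l * x\<rfloor> div 2 ^ (l - k')" if "k' < l" for k'
      using dyadic_subset_ancestor[of k' l "\<lfloor>2 ^ l * x\<rfloor>"] that by (auto simp: mem_dyadic subset_iff)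
    have "sel l \<lfloor>2 ^ l * x\<rfloor>" using Rl nl anc by (auto simp: sel_def)
    then have "x \<in> X (prod_encode (l, int_encode \<lfloor>2 ^ l * x\<rfloor>))"
      by (simp add: X_def KJ mem_dyadic)
    then show "x \<in> (\<Union>i. X i)" by blast
  qed
  moreover have "X i \<in> sets lebesgue" for i by (simp add: X_def)
  ultimately show ?thesis by blast
qed

lemma open_contains_dyadic:
  assumes "open V" "x \<in> V"
  obtains k where "dyadic k \<lfloor>2 ^ k * x\<rfloor> \<subseteq> V"
proof -
  obtain e where e: "e > 0" "ball x e \<subseteq> V" using assms openE by blast
  obtain k where k: "(1/2::real) ^ k < e" using real_arch_pow_inv[OF e(1), of "1/2"] by auto
  have "dyadic k \<lfloor>2 ^ k * x\<rfloor> \<subseteq> ball x e"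
  proof
    fix y assume "y \<in> dyadic k \<lfloor>2 ^ k * x\<rfloor>"
    then have "\<lfloor>2 ^ k * y\<rfloor> = \<lfloor>2 ^ k * x\<rfloor>" by (simp add: mem_dyadic)
    then have "\<bar>2 ^ k * y - 2 ^ k * x\<bar> < 1" by linarith
    then have "2 ^ k * \<bar>y - x\<bar> < 1" by (simp add: abs_mult flip: right_diff_distrib)
    then have "\<bar>y - x\<bar> < (1/2) ^ k" by (simp add: field_simps)
    then show "y \<in> ball x e" using k by (simp add: dist_real_def abs_minus_commute)
  qed
  with e that show ?thesis by blast
qed

text \<open>The selected cells are the maximal dyadic cells on which the mean of \<open>\<bar>u\<bar>\<close> exceeds \<open>h\<close>. Since
  the whole unit interval is not selected, each selected cell has a parent that is not, and this
  bounds the mean over the cell by \<open>2h\<close>. Off the selected cells \<open>\<bar>u\<bar> \<le> h\<close> almost everywhere: the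
  exceptional set can be covered, with little loss of measure, by disjoint cells that meet it, and on
  these the mean of \<open>\<bar>u\<bar>\<close> is at most \<open>h\<close>.\<close>

lemma Calderon_Zygmund_cells:
  fixes u :: "real \<Rightarrow> 'a::{real_normed_field, euclidean_space}" and n :: int
  assumes u: "u \<in> borel_measurable lebesgue" "\<And>x. norm (u x) \<le> M"
    and zero: "\<And>x. x \<notin> {of_int n..<of_int n + 1} \<Longrightarrow> u x = 0"
    and h: "0 < h" "(LINT x|lebesgue. norm (u x)) \<le> h"
  shows "\<exists>X :: nat \<Rightarrow> real set. disjoint_family X \<and> (\<forall>i. X i \<in> sets lebesgue) \<and>
    (\<forall>i. X i \<noteq> {} \<longrightarrow> (\<exists>p q. X i = {p..<q} \<and> p < q \<and> of_int n \<le> p \<and> q \<le> of_int n + 1 \<and>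
        (LINT x|lebesgue. indicator (X i) x * norm (u x)) \<le> 2 * h * (q - p))) \<and>
    h * measure lebesgue (\<Union>i. X i) \<le> (LINT x|lebesgue. norm (u x)) \<and>
    (AE x in lebesgue. x \<notin> (\<Union>i. X i) \<longrightarrow> norm (u x) \<le> h)"
proof -
  let ?J = "{real_of_int n..<of_int n + 1}"
  \<comment> \<open>the measure with density \<open>\<bar>u\<bar>\<close>, so that the sums over disjoint cells are instances of countable additivity\<close>
  define N where "N = density lebesgue (\<lambda>x. ennreal (norm (u x)))"
  have Jlm: "?J \<in> lmeasurable" by (rule bounded_set_imp_lmeasurable) auto
  have iu: "integrable lebesgue u"
    by (rule integrable_bounded_support(1)[OF u Jlm zero])
  have setsN [simp]: "sets N = sets lebesgue" by (simp add: N_def)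
  have iE: "integrable lebesgue (\<lambda>x. indicator E x * norm (u x))" if "E \<in> sets lebesgue" for E
    using integrable_mult_indicator[OF that integrable_norm[OF iu]] by simp
  have N: "emeasure N E = ennreal (LINT x|lebesgue. indicator E x * norm (u x))"
    if E: "E \<in> sets lebesgue" for E
  proof -
    have "emeasure N E = (\<integral>\<^sup>+x. ennreal (norm (u x)) * indicator E x \<partial>lebesgue)"
      unfolding N_def by (rule emeasure_density) (use u E in auto)
    also have "\<dots> = (\<integral>\<^sup>+x. ennreal (indicator E x * norm (u x)) \<partial>lebesgue)"
      by (rule nn_integral_cong) (auto simp: indicator_def)
    also have "\<dots> = ennreal (LINT x|lebesgue. indicator E x * norm (u x))"
      by (rule nn_integral_eq_integral[OF iE[OF E]]) auto
    finally show ?thesis .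
  qed
  have NU: "emeasure N E \<le> ennreal (LINT x|lebesgue. norm (u x))" if "E \<in> sets lebesgue" for E
    unfolding N[OF that]
    by (intro ennreal_leI integral_mono iE that integrable_norm iu) (auto simp: indicator_def)
  define bad where "bad k j \<longleftrightarrow> ennreal h * emeasure lebesgue (dyadic k j) < emeasure N (dyadic k j)" for k j
  obtain X :: "nat \<Rightarrow> real set" where X': "disjoint_family X" "\<forall>i. X i \<in> sets lebesgue"
      "\<forall>i. X i \<noteq> {} \<longrightarrow> (\<exists>k j. X i = dyadic k j \<and> bad k j \<and> (\<forall>k'<k. \<not> bad k' (j div 2 ^ (k - k'))))"
      "\<forall>k j. bad k j \<longrightarrow> dyadic k j \<subseteq> (\<Union>i. X i)"
    using maximal_dyadic[of bad] by blast
  note X = X'(1) X'(3,4,2)[rule_format]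
  let ?O = "\<Union>i. X i"
  have Osets: "?O \<in> sets lebesgue" using X(4) by auto
  have bad_sub: "dyadic k j \<subseteq> ?J" if "bad k j" for k j
  proof -
    define m where "m = j div 2 ^ k"
    have sub: "dyadic k j \<subseteq> dyadic 0 m"
      using dyadic_subset_ancestor[of 0 k j] by (simp add: m_def)
    have "m = n"
    proof (rule ccontr)
      assume "m \<noteq> n"
      then have "x \<notin> ?J" if "x \<in> dyadic k j" for x
        using subsetD[OF sub that] by (auto simp: dyadic_def)
      then have z: "indicat_real (dyadic k j) x * norm (u x) = 0" for x
        using zero[of x] by (cases "x \<in> dyadic k j") auto
      have "(LINT x|lebesgue. indicat_real (dyadic k j) x * norm (u x)) = 0"
        unfolding z by simp
      then show False using that N[of "dyadic k j"] by (simp add: bad_def)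
    qed
    then show ?thesis using sub by (simp add: dyadic_def)
  qed
  have cells: "\<exists>p q. X i = {p..<q} \<and> p < q \<and> of_int n \<le> p \<and> q \<le> of_int n + 1 \<and>
        (LINT x|lebesgue. indicator (X i) x * norm (u x)) \<le> 2 * h * (q - p)" if ne: "X i \<noteq> {}" for i
  proof -
    obtain k j where kj: "X i = dyadic k j" "bad k j" "\<And>k'. k' < k \<Longrightarrow> \<not> bad k' (j div 2 ^ (k - k'))"
      using X(2)[OF ne] by blast
    let ?p = "real_of_int j / 2 ^ k" and ?q = "(real_of_int j + 1) / 2 ^ k"
    have Xi: "X i = {?p..<?q}" by (simp add: kj dyadic_def)
    have len: "?q - ?p = 1 / 2 ^ k" by (simp add: diff_divide_distrib[symmetric])
    then have pq: "?p < ?q" by (smt (verit) zero_less_divide_1_iff zero_less_power)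
    \<comment> \<open>a cell of level 0 would be the whole unit interval, where the mean is at most \<open>h\<close>\<close>
    have "k \<noteq> 0"
    proof
      assume "k = 0"
      then have "ennreal h < emeasure N (X i)"
        using kj(1,2) by (simp add: bad_def emeasure_dyadic)
      also have "\<dots> \<le> ennreal h" using NU[OF X(4)] h(2) by (meson ennreal_leI order_trans)
      finally show False by simp
    qed
    then obtain k' where k': "k = Suc k'" using not0_implies_Suc by blast
    have "emeasure N (X i) \<le> emeasure N (dyadic k' (j div 2 ^ (k - k')))"
      unfolding kj(1) by (rule emeasure_mono) (use dyadic_subset_ancestor[of k' k j] k' in auto)
    also have "\<dots> \<le> ennreal h * emeasure lebesgue (dyadic k' (j div 2 ^ (k - k')))"
      using kj(3)[of k'] k' by (simp add: bad_def)
    also have "\<dots> = ennreal (2 * h * (?q - ?p))"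
    proof -
      have "2 * h * (?q - ?p) = h * (1 / 2 ^ k')" unfolding len by (simp add: k')
      then show ?thesis unfolding emeasure_dyadic using h(1) by (simp add: ennreal_mult[symmetric])
    qed
    finally have "(LINT x|lebesgue. indicator (X i) x * norm (u x)) \<le> 2 * h * (?q - ?p)"
      unfolding N[OF X(4)] using h(1) pq by (subst (asm) ennreal_le_iff) auto
    moreover have "of_int n \<le> ?p" "?q \<le> of_int n + 1"
      using bad_sub[OF kj(2)] pq unfolding kj(1)[symmetric] Xi
      by (auto simp: ivl_subset)
    ultimately show ?thesis using Xi pq by blast
  qed
  have Xbad: "ennreal h * emeasure lebesgue (X i) \<le> emeasure N (X i)" for i
    using X(2)[of i] by (cases "X i = {}") (auto simp: bad_def)
  have "ennreal h * emeasure lebesgue ?O = ennreal h * (\<Sum>i. emeasure lebesgue (X i))"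
    by (subst suminf_emeasure) (use X(1,4) in auto)
  also have "\<dots> = (\<Sum>i. ennreal h * emeasure lebesgue (X i))" by simp
  also have "\<dots> \<le> (\<Sum>i. emeasure N (X i))" by (intro suminf_le Xbad) auto
  also have "\<dots> = emeasure N ?O" by (rule suminf_emeasure) (use X(1,4) in auto)
  also have "\<dots> \<le> ennreal (LINT x|lebesgue. norm (u x))" by (rule NU[OF Osets])
  finally have Omeas: "ennreal h * emeasure lebesgue ?O \<le> ennreal (LINT x|lebesgue. norm (u x))" .
  have OJ: "?O \<subseteq> ?J" using X(2) bad_sub by (metis UN_least empty_subsetI)
  then have Olm: "?O \<in> lmeasurable"
    using fmeasurableI2[OF Jlm] Osets by blast
  have fin: "h * measure lebesgue ?O \<le> (LINT x|lebesgue. norm (u x))"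
    using Omeas h(1) unfolding emeasure_eq_measure2[OF Olm]
    by (simp add: ennreal_mult[symmetric] integral_nonneg_AE)
  define A where "A = {x. h < norm (u x)} - ?O"
  have AJ: "A \<subseteq> ?J" using zero h(1) by (force simp: A_def)
  have Asets: "A \<in> sets lebesgue"
  proof -
    have "{x \<in> space lebesgue. h < norm (u x)} \<in> sets lebesgue"
      using u(1) by measurable
    then show ?thesis using Osets by (auto simp: A_def)
  qed
  have Alm: "A \<in> lmeasurable"
    using fmeasurableI2[OF Jlm] AJ Asets by blast
  \<comment> \<open>on \<open>A\<close> the density exceeds \<open>h\<close>, so this inequality forces \<open>A\<close> to be a null set\<close>
  have "emeasure N A \<le> ennreal (h * measure lebesgue A)"
  proof (rule ennreal_le_epsilon)
    fix e :: real assume e: "0 < e"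
    then have "0 < e / h" using h(1) by simp
    then obtain V where V: "open V" "A \<subseteq> V" "V - A \<in> lmeasurable" "emeasure lebesgue (V - A) < ennreal (e / h)"
      using sets_lebesgue_outer_open[OF Asets] by metis
    have Vsets: "V \<in> sets lebesgue" using V(1) by auto
    let ?P = "\<lambda>k j. dyadic k j \<subseteq> V \<and> dyadic k j \<inter> A \<noteq> {}"
    obtain Y :: "nat \<Rightarrow> real set" where Y': "disjoint_family Y" "\<forall>i. Y i \<in> sets lebesgue"
      "\<forall>i. Y i \<noteq> {} \<longrightarrow> (\<exists>k j. Y i = dyadic k j \<and> ?P k j)"
      "\<forall>k j. ?P k j \<longrightarrow> dyadic k j \<subseteq> (\<Union>i. Y i)"
      using maximal_dyadic[of ?P] by metis
    note Y = Y'(1) Y'(3,4,2)[rule_format]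
    have AY: "A \<subseteq> (\<Union>i. Y i)"
    proof
      fix x assume x: "x \<in> A"
      then obtain k where k: "dyadic k \<lfloor>2 ^ k * x\<rfloor> \<subseteq> V" using open_contains_dyadic V by blast
      have "x \<in> dyadic k \<lfloor>2 ^ k * x\<rfloor>" by (simp add: mem_dyadic)
      then show "x \<in> (\<Union>i. Y i)" using Y(3)[of k "\<lfloor>2 ^ k * x\<rfloor>"] k x by blast
    qed
    have YV: "(\<Union>i. Y i) \<subseteq> V" using Y(2) by (metis UN_least empty_subsetI)
    have good: "emeasure N (Y i) \<le> ennreal h * emeasure lebesgue (Y i)" for i
    proof (cases "Y i = {}")
      case False
      then obtain k j where kj: "Y i = dyadic k j" "dyadic k j \<inter> A \<noteq> {}" using Y(2) by blast
      have "\<not> bad k j" using X(3)[of k j] kj(2) by (auto simp: A_def)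
      then show ?thesis by (simp add: bad_def kj(1))
    qed simp
    have "emeasure N A \<le> emeasure N (\<Union>i. Y i)" by (rule emeasure_mono[OF AY]) (use Y(4) in auto)
    also have "\<dots> = (\<Sum>i. emeasure N (Y i))" by (subst suminf_emeasure) (use Y(1,4) in auto)
    also have "\<dots> \<le> (\<Sum>i. ennreal h * emeasure lebesgue (Y i))" by (intro suminf_le good) auto
    also have "\<dots> = ennreal h * (\<Sum>i. emeasure lebesgue (Y i))" by simp
    also have "(\<Sum>i. emeasure lebesgue (Y i)) = emeasure lebesgue (\<Union>i. Y i)"
      by (rule suminf_emeasure) (use Y(1,4) in auto)
    also have "ennreal h * emeasure lebesgue (\<Union>i. Y i) \<le> ennreal h * emeasure lebesgue V"
      by (intro mult_left_mono emeasure_mono YV Vsets) auto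
    also have "emeasure lebesgue V = emeasure lebesgue A + emeasure lebesgue (V - A)"
      using V(2) plus_emeasure[OF Asets, of "V - A"] Vsets Asets by (auto simp: Un_absorb1)
    also have "\<dots> \<le> ennreal (measure lebesgue A) + ennreal (e / h)"
      using V(4) by (intro add_mono) (auto simp: emeasure_eq_measure2[OF Alm])
    also have "ennreal h * \<dots> = ennreal (h * measure lebesgue A) + ennreal e"
      using h(1) e by (simp add: distrib_left ennreal_mult[symmetric] ennreal_plus[symmetric] del: ennreal_plus)
    finally show "emeasure N A \<le> ennreal (h * measure lebesgue A) + ennreal e" by (simp add: mult_left_mono)
  qed
  then have le: "(LINT x|lebesgue. indicator A x * norm (u x)) \<le> h * measure lebesgue A"
    unfolding N[OF Asets] using h(1) by (subst (asm) ennreal_le_iff) auto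
  have iA: "integrable lebesgue (\<lambda>x. indicat_real A x * h)"
    using Alm by (intro integrable_mult_left integrable_real_indicator) (auto simp: fmeasurable_def)
  have iAu: "integrable lebesgue (\<lambda>x. indicat_real A x * (norm (u x) - h))"
    using iA iE[OF Asets] by (simp add: right_diff_distrib)
  have "(LINT x|lebesgue. indicat_real A x * (norm (u x) - h)) \<le> 0"
    using le iA iE[OF Asets] Alm by (simp add: right_diff_distrib fmeasurableD mult.commute[of h])
  moreover have pos: "0 \<le> indicat_real A x * (norm (u x) - h)" for x
    by (auto simp: indicator_def A_def)
  then have "0 \<le> (LINT x|lebesgue. indicat_real A x * (norm (u x) - h))"
    by (intro integral_nonneg_AE) auto
  ultimately have "(LINT x|lebesgue. indicat_real A x * (norm (u x) - h)) = 0" by simp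
  then have "AE x in lebesgue. indicat_real A x * (norm (u x) - h) = 0"
    using integral_nonneg_eq_0_iff_AE[OF iAu] pos by auto
  then have "AE x in lebesgue. x \<notin> ?O \<longrightarrow> norm (u x) \<le> h"
    by eventually_elim (auto simp: A_def indicator_def split: if_splits)
  with X(1,4) cells fin show ?thesis by blast
qed

text \<open>The bad part \<open>u - v\<close> belongs to the atomic space with a norm that is small when the mean of
  \<open>\<bar>u\<bar>\<close> is small compared with \<open>h\<close>; the good part \<open>v\<close> is bounded by \<open>2h\<close>. The good part is truncated on
  a null set so that this bound holds everywhere.\<close>

lemma Calderon_Zygmund_decomposition:
  fixes u :: "real \<Rightarrow> 'a::{real_normed_field, euclidean_space}" and n :: int
  assumes u: "u \<in> borel_measurable lebesgue" "\<And>x. norm (u x) \<le> M"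
    and zero: "\<And>x. x \<notin> {of_int n..<of_int n + 1} \<Longrightarrow> u x = 0"
    and h: "0 < h" "(LINT x|lebesgue. norm (u x)) \<le> h"
  obtains v where "v \<in> borel_measurable lebesgue" "\<And>x. norm (v x) \<le> 2 * h"
    "\<And>x. x \<notin> {of_int n..<of_int n + 1} \<Longrightarrow> v x = 0"
    "(\<lambda>x. u x - v x) \<in> H1_2s"
    "norm_H1_2s (\<lambda>x. u x - v x) \<le> 2 * M / h * (LINT x|lebesgue. norm (u x))"
proof -
  let ?J = "{real_of_int n..<of_int n + 1}"
  obtain X :: "nat \<Rightarrow> real set" where X': "disjoint_family X" "\<forall>i. X i \<in> sets lebesgue"
    and cell': "\<forall>i. X i \<noteq> {} \<longrightarrow> (\<exists>p q. X i = {p..<q} \<and> p < q \<and> of_int n \<le> p \<and> q \<le> of_int n + 1 \<and>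
        (LINT x|lebesgue. indicator (X i) x * norm (u x)) \<le> 2 * h * (q - p))"
    and Omeas: "h * measure lebesgue (\<Union>i. X i) \<le> (LINT x|lebesgue. norm (u x))"
    and off: "AE x in lebesgue. x \<notin> (\<Union>i. X i) \<longrightarrow> norm (u x) \<le> h"
    using Calderon_Zygmund_cells[where n = n, OF u zero h] by blast
  note X = X'(1) X'(2)[rule_format] and cell = cell'[rule_format]
  have M: "0 \<le> M" using u(2) norm_ge_zero order_trans by blast
  have Jlm: "?J \<in> lmeasurable" by (rule bounded_set_imp_lmeasurable) auto
  have iu: "integrable lebesgue u" by (rule integrable_bounded_support(1)[OF u Jlm zero])
  have XJ: "X i \<subseteq> ?J" for i using cell[of i] by (cases "X i = {}") auto
  \<comment> \<open>Endpoints of the cells; an empty cell gets the dummy interval from 0 to 1.\<close>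
  define R where "R i p q \<longleftrightarrow> p < q \<and> X i \<subseteq> {p..q} \<and> (0 \<le> p \<or> q \<le> 0) \<and> (X i \<noteq> {} \<longrightarrow>
        measure lebesgue (X i) = q - p \<and>
        (LINT x|lebesgue. indicator (X i) x * norm (u x)) \<le> 2 * h * (q - p))" for i and p q :: real
  have "\<exists>p q. R i p q" for i
  proof (cases "X i = {}")
    case True
    then show ?thesis unfolding R_def by (intro exI[of _ 0] exI[of _ 1]) auto
  next
    case False
    then obtain p q where pq: "X i = {p..<q}" "p < q" "of_int n \<le> p" "q \<le> of_int n + 1"
        "(LINT x|lebesgue. indicator (X i) x * norm (u x)) \<le> 2 * h * (q - p)"
      using cell by blast
    have "0 \<le> n \<or> n + 1 \<le> 0" by linarith
    then have "0 \<le> real_of_int n \<or> real_of_int n + 1 \<le> 0" by (metis of_int_0_le_iff of_int_1 of_int_add of_int_le_0_iff)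
    then have "0 \<le> p \<or> q \<le> 0" using pq by linarith
    then show ?thesis using pq unfolding R_def by (intro exI[of _ p] exI[of _ q]) auto
  qed
  then obtain p q where R: "\<And>i. R i (p i) (q i)" by metis
  have pq: "\<And>i. p i < q i" "\<And>i. X i \<subseteq> {p i..q i}" "\<And>i. 0 \<le> p i \<or> q i \<le> 0"
     "\<And>i. X i \<noteq> {} \<Longrightarrow> measure lebesgue (X i) = q i - p i"
     "\<And>i. X i \<noteq> {} \<Longrightarrow> (LINT x|lebesgue. indicator (X i) x * norm (u x)) \<le> 2 * h * (q i - p i)"
    using R by (auto simp: R_def)
  have Xlm: "X i \<in> lmeasurable" for i using fmeasurableI2[OF Jlm XJ X(2)] .
  have iX: "integrable lebesgue (\<lambda>x. indicat_real (X i) x *\<^sub>R u x)" for i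
    by (rule integrable_mult_indicator[OF X(2) iu])
  define av where "av i = (1 / measure lebesgue (X i)) *\<^sub>R (LINT x|lebesgue. indicat_real (X i) x *\<^sub>R u x)" for i
  have av_int: "norm (av i) \<le> (LINT x|lebesgue. indicator (X i) x * norm (u x)) / measure lebesgue (X i)" for i
  proof -
    have "norm (LINT x|lebesgue. indicat_real (X i) x *\<^sub>R u x)
        \<le> (LINT x|lebesgue. norm (indicat_real (X i) x *\<^sub>R u x))" by (rule integral_norm_bound)
    then show ?thesis by (simp add: av_def divide_right_mono)
  qed
  have av_h: "norm (av i) \<le> 2 * h" if "X i \<noteq> {}" for i
  proof -
    have "0 < measure lebesgue (X i)" using pq(1,4) that by simp
    then show ?thesis
      using av_int[of i] pq(5)[OF that] pq(4)[OF that]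
      by (smt (verit) pos_divide_le_eq)
  qed
  have av_M: "norm (av i) \<le> M" if "X i \<noteq> {}" for i
  proof -
    have pos: "0 < measure lebesgue (X i)" using pq(1,4) that by simp
    have "(LINT x|lebesgue. indicator (X i) x * norm (u x)) \<le> (LINT x|lebesgue. indicat_real (X i) x * M)"
    proof (rule integral_mono)
      show "integrable lebesgue (\<lambda>x. indicator (X i) x * norm (u x))"
        using integrable_norm[OF iX[of i]] by simp
      show "integrable lebesgue (\<lambda>x. indicat_real (X i) x * M)"
        using Xlm[of i] by (intro integrable_mult_left integrable_real_indicator) (auto simp: fmeasurable_def)
    qed (use u(2) in \<open>auto intro: mult_left_mono\<close>)
    also have "\<dots> = M * measure lebesgue (X i)" using Xlm[of i] by (simp add: fmeasurableD)
    finally show ?thesis using av_int[of i] pos by (smt (verit) pos_divide_le_eq)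
  qed
  define b where "b i x = indicat_real (X i) x *\<^sub>R (u x - av i)" for i x
  define B where "B x = (\<Sum>i. b i x)" for x
  have bm: "b i \<in> borel_measurable lebesgue" for i
    unfolding b_def using u(1) X(2)[of i]
    by (intro borel_measurable_scaleR borel_measurable_diff borel_measurable_indicator) auto
  have bM: "norm (b i x) \<le> (if X i = {} then 0 else 2 * M)" for i x
  proof (cases "x \<in> X i")
    case True
    then have "norm (u x - av i) \<le> M + M" using av_M[of i] u(2)[of x] by (smt (verit) empty_iff norm_triangle_ineq4)
    then show ?thesis using True by (auto simp: b_def)
  qed (use M in \<open>auto simp: b_def\<close>)
  have b0: "(LINT x|lebesgue. b i x) = 0" for i
  proof (cases "X i = {}")
    case False
    then have "measure lebesgue (X i) \<noteq> 0" using pq(1)[of i] pq(4)[of i] by simp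
    moreover have "(LINT x|lebesgue. b i x)
        = (LINT x|lebesgue. indicat_real (X i) x *\<^sub>R u x) - (LINT x|lebesgue. indicat_real (X i) x *\<^sub>R av i)"
      unfolding b_def scaleR_diff_right
      by (rule Bochner_Integration.integral_diff[OF iX])
        (use Xlm[of i] in \<open>auto simp: fmeasurable_def intro!: integrable_scaleR_left integrable_real_indicator\<close>)
    moreover have "(LINT x|lebesgue. indicat_real (X i) x *\<^sub>R av i) = measure lebesgue (X i) *\<^sub>R av i"
    proof -
      have "integrable lebesgue (indicat_real (X i))"
        using Xlm[of i] by (intro integrable_real_indicator) (auto simp: fmeasurable_def)
      then show ?thesis using Xlm[of i] by (simp add: fmeasurableD)
    qed
    ultimately show ?thesis by (simp add: av_def)
  qed (simp add: b_def)
  have only: "b j x = 0" if "x \<in> X i" "j \<noteq> i" for i j x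
    using that X(1) by (auto simp: b_def disjoint_family_on_def indicator_def)
  have none: "b j x = 0" if "x \<notin> (\<Union>i. X i)" for j x
    using that by (auto simp: b_def)
  have part: "(\<Sum>j<m. b j x) = (if i < m then b i x else 0)" if "x \<in> X i" for m i x
  proof -
    have "(\<Sum>j<m. b j x) = (\<Sum>j<m. if j = i then b j x else 0)"
      by (rule sum.cong) (use only[OF that] in auto)
    then show ?thesis by simp
  qed
  have partM: "norm (\<Sum>j<m. b j x) \<le> 2 * M" for m x
  proof (cases "x \<in> (\<Union>i. X i)")
    case True
    then obtain i where "x \<in> X i" by blast
    then show ?thesis using bM[of i x] M by (auto simp: part split: if_splits)
  qed (use none M in simp)
  have conv: "(\<lambda>m. \<Sum>j<m. b j x) \<longlonglongrightarrow> B x" for x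
  proof -
    have "summable (\<lambda>j. b j x)"
    proof (cases "x \<in> (\<Union>i. X i)")
      case True
      then obtain i where "x \<in> X i" by blast
      then show ?thesis using only by (intro summable_finite[of "{i}"]) auto
    qed (use none in simp)
    then show ?thesis unfolding B_def by (rule summable_LIMSEQ)
  qed
  have Bm: "B \<in> borel_measurable lebesgue"
    by (rule borel_measurable_LIMSEQ_metric[OF _ conv]) (use bm in auto)
  have BX: "B x = u x - av i" if "x \<in> X i" for x i
  proof -
    have "B x = b i x" unfolding B_def using only[OF that] by (subst suminf_finite[of "{i}"]) auto
    then show ?thesis using that by (simp add: b_def)
  qed
  have B_none: "B x = 0" if "x \<notin> (\<Union>i. X i)" for x
    unfolding B_def using none[OF that] by simp
  have BM: "norm (B x) \<le> 2 * M" for x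
    by (rule Lim_bounded[OF tendsto_norm[OF conv]]) (use partM in blast)
  have B_out: "B x = 0" if "x \<notin> ?J" for x using B_none XJ that by blast
  \<comment> \<open>truncated where the bound fails, which happens on a null set only\<close>
  define v where "v x = (if norm (u x - B x) \<le> 2 * h then u x - B x else 0)" for x
  have vm: "v \<in> borel_measurable lebesgue"
    unfolding v_def
  proof (rule measurable_If)
    have "(\<lambda>x. norm (u x - B x)) \<in> borel_measurable lebesgue" using u(1) Bm by measurable
    then show "{x \<in> space lebesgue. norm (u x - B x) \<le> 2 * h} \<in> sets lebesgue" by measurable
  qed (use u(1) Bm in auto)
  have vh: "norm (v x) \<le> 2 * h" for x using h(1) by (simp add: v_def)
  have v_out: "v x = 0" if "x \<notin> ?J" for x using B_out zero that by (simp add: v_def)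
  have uvB: "AE x in lebesgue. u x - v x = B x"
    using off
  proof eventually_elim
    case (elim x)
    have "norm (u x - B x) \<le> 2 * h"
    proof (cases "x \<in> (\<Union>i. X i)")
      case True
      then obtain i where "x \<in> X i" by blast
      then show ?thesis using av_h[of i] by (auto simp: BX)
    next
      case False
      then show ?thesis using elim h(1) by (simp add: B_none)
    qed
    then show ?case by (simp add: v_def)
  qed
  let ?w = "\<lambda>x. u x - v x"
  have wM: "norm (?w x) \<le> 3 * M" for x
    using u(2)[of x] BM[of x] M by (auto simp: v_def)
  have wm: "?w \<in> borel_measurable lebesgue" using u(1) vm by auto
  have iw: "integrable lebesgue ?w"
    by (rule integrable_bounded_support(1)[OF wm wM Jlm]) (use zero v_out in simp)
  have L1: "(\<lambda>m. LINT x|lebesgue. norm (?w x - (\<Sum>j<m. b j x))) \<longlonglongrightarrow> (LINT x::real|lebesgue. (0::real))"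
  proof (rule integral_dominated_convergence[where w = "\<lambda>x. indicat_real ?J x * (5 * M)"])
    show "integrable lebesgue (\<lambda>x. indicat_real ?J x * (5 * M))"
      using Jlm by (intro integrable_mult_left integrable_real_indicator) (auto simp: fmeasurable_def)
    show "AE x in lebesgue. (\<lambda>m. norm (?w x - (\<Sum>j<m. b j x))) \<longlonglongrightarrow> 0"
      using uvB
    proof eventually_elim
      case (elim x)
      have "(\<lambda>m. norm (?w x - (\<Sum>j<m. b j x))) \<longlonglongrightarrow> norm (?w x - B x)"
        by (intro tendsto_intros conv)
      then show ?case using elim by simp
    qed
    fix m :: nat
    have "norm (norm (?w x - (\<Sum>j<m. b j x))) \<le> indicat_real ?J x * (5 * M)" for x
    proof (cases "x \<in> ?J")
      case True
      then show ?thesis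
        using norm_triangle_ineq4[of "?w x" "\<Sum>j<m. b j x"] wM[of x] partM[of x m] by simp
    next
      case False
      then have "x \<notin> (\<Union>i. X i)" using XJ by blast
      then show ?thesis using False none zero v_out by simp
    qed
    then show "AE x in lebesgue. norm (norm (?w x - (\<Sum>j<m. b j x))) \<le> indicat_real ?J x * (5 * M)"
      by simp
  qed (use wm bm in auto)
  have ms: "(\<lambda>i. measure lebesgue (X i)) sums measure lebesgue (\<Union>i. X i)"
  proof (rule measure_UNION)
    have "(\<Union>i. X i) \<in> lmeasurable" by (rule fmeasurableI2[OF Jlm]) (use XJ X(2) in auto)
    then show "emeasure lebesgue (\<Union>i. X i) \<noteq> \<infinity>" by (auto simp: fmeasurable_def)
  qed (use X in auto)
  have coeff: "(if X i = {} then 0 else 2 * M) * (q i - p i) = 2 * M * measure lebesgue (X i)" for i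
    using pq(4)[of i] by simp
  have csum: "(\<lambda>i. (if X i = {} then 0 else 2 * M) * (q i - p i)) sums (2 * M * measure lebesgue (\<Union>i. X i))"
    unfolding coeff by (rule sums_mult[OF ms])
  have b_out: "b j x = 0" if "x \<notin> {p j..q j}" for j x
  proof -
    have "x \<notin> X j" using that pq(2)[of j] by blast
    then show ?thesis by (simp add: b_def)
  qed
  have L1': "(\<lambda>m. LINT x|lebesgue. norm (?w x - (\<Sum>j<m. b j x))) \<longlonglongrightarrow> 0" using L1 by simp
  note H1 = H1_2s_seriesI[OF pq(1,3) bm bM b_out b0 sums_summable[OF csum] iw L1']
  have "(\<Sum>i. (if X i = {} then 0 else 2 * M) * (q i - p i)) = 2 * M * measure lebesgue (\<Union>i. X i)"
    using csum by (simp add: sums_iff)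
  moreover have "2 * M * measure lebesgue (\<Union>i. X i) \<le> 2 * M / h * (LINT x|lebesgue. norm (u x))"
    using mult_left_mono[OF Omeas, of "2 * M / h"] M h(1) by simp
  ultimately show ?thesis using that[of v] vm vh v_out H1 by auto
qed

section \<open>Radon--Nikodym for signed set functions\<close>

lemma (in finite_measure) nonneg_set_function_density:
  fixes p :: "'a set \<Rightarrow> real"
  assumes nonneg: "\<And>A. A \<in> sets M \<Longrightarrow> 0 \<le> p A"
    and sums: "\<And>A :: nat \<Rightarrow> 'a set. range A \<subseteq> sets M \<Longrightarrow> disjoint_family A \<Longrightarrow> (\<lambda>i. p (A i)) sums p (\<Union>i. A i)"
    and null: "\<And>A. A \<in> null_sets M \<Longrightarrow> p A = 0"
  shows "\<exists>g. integrable M g \<and> (\<forall>A\<in>sets M. p A = (LINT x|M. indicator A x * g x))"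
proof -
  define N where "N = measure_of (space M) (sets M) (\<lambda>A. ennreal (p A))"
  have emp: "p {} = 0" by (rule null) auto
  have ca: "countably_additive (sets M) (\<lambda>A. ennreal (p A))"
  proof (rule countably_additiveI)
    fix A :: "nat \<Rightarrow> 'a set" assume A: "range A \<subseteq> sets M" "disjoint_family A"
    have s: "(\<lambda>i. p (A i)) sums p (\<Union>i. A i)" using sums A by blast
    show "(\<Sum>i. ennreal (p (A i))) = ennreal (p (\<Union>i. A i))"
      by (rule suminf_ennreal_eq[OF _ s]) (use A nonneg in auto)
  qed
  have setsN: "sets N = sets M" by (simp add: N_def)
  have eN: "emeasure N A = ennreal (p A)" if "A \<in> sets M" for A
    unfolding N_def using that emp ca
    by (intro emeasure_measure_of_sigma) (auto simp: positive_def sets.sigma_algebra_axioms)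
  have "absolutely_continuous M N"
    unfolding absolutely_continuous_def
  proof
    fix A assume A: "A \<in> null_sets M"
    then have "A \<in> sets M" by auto
    with eN[OF this] null[OF A] show "A \<in> null_sets N" by (auto simp: null_sets_def setsN)
  qed
  then obtain f where f: "f \<in> borel_measurable M" "density M f = N"
    using Radon_Nikodym setsN by blast
  have int: "(\<integral>\<^sup>+x. f x * indicator A x \<partial>M) = ennreal (p A)" if "A \<in> sets M" for A
    using that eN[OF that] f(2) emeasure_density[OF f(1) that] by simp
  have "(\<integral>\<^sup>+x. f x \<partial>M) = (\<integral>\<^sup>+x. f x * indicator (space M) x \<partial>M)"
    by (intro nn_integral_cong) auto
  also have "\<dots> \<noteq> \<infinity>" using int[of "space M"] by simp
  finally have fin: "AE x in M. f x \<noteq> \<infinity>" by (rule nn_integral_PInf_AE[OF f(1)])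
  define g where "g = (\<lambda>x. enn2real (f x))"
  have gm: "g \<in> borel_measurable M" using f(1) by (simp add: g_def)
  have fg: "AE x in M. f x = ennreal (g x)"
    using fin by eventually_elim (auto simp: g_def less_top)
  have nn: "(\<integral>\<^sup>+x. ennreal (indicator A x * g x) \<partial>M) = ennreal (p A)" if A: "A \<in> sets M" for A
  proof -
    have "(\<integral>\<^sup>+x. ennreal (indicator A x * g x) \<partial>M) = (\<integral>\<^sup>+x. f x * indicator A x \<partial>M)"
    proof (rule nn_integral_cong_AE)
      show "AE x in M. ennreal (indicator A x * g x) = f x * indicator A x"
        using fg by eventually_elim (auto simp: indicator_def)
    qed
    then show ?thesis using int A by simp
  qed
  have ig: "integrable M (\<lambda>x. indicator A x * g x)" if A: "A \<in> sets M" for A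
    by (rule integrableI_nn_integral_finite[where x = "p A"])
      (use gm A nn nonneg in \<open>auto simp: g_def\<close>)
  have "p A = (LINT x|M. indicator A x * g x)" if A: "A \<in> sets M" for A
    using nn[OF A] ig[OF A] nonneg[OF A]
    by (subst integral_eq_nn_integral) (auto simp: g_def)
  moreover have "integrable M g"
    using ig[of "space M"] by (simp cong: Bochner_Integration.integrable_cong)
  ultimately show ?thesis by blast
qed

text \<open>The signed case reduces to the nonnegative one through the positive variation
  \<open>p A = sup {\<nu> F | F \<subseteq> A}\<close>.\<close>

lemma (in finite_measure) signed_set_function_density:
  fixes \<nu> :: "'a set \<Rightarrow> real"
  assumes bound: "\<And>A. A \<in> sets M \<Longrightarrow> \<bar>\<nu> A\<bar> \<le> C"
    and sums: "\<And>A :: nat \<Rightarrow> 'a set. range A \<subseteq> sets M \<Longrightarrow> disjoint_family A \<Longrightarrow> (\<lambda>i. \<nu> (A i)) sums \<nu> (\<Union>i. A i)"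
    and null: "\<And>A. A \<in> null_sets M \<Longrightarrow> \<nu> A = 0"
  shows "\<exists>g. integrable M g \<and> (\<forall>A\<in>sets M. \<nu> A = (LINT x|M. indicator A x * g x))"
proof -
  define p where "p A = (SUP F\<in>{F \<in> sets M. F \<subseteq> A}. \<nu> F)" for A
  have emp: "\<nu> {} = 0" by (rule null) auto
  have bdd: "bdd_above (\<nu> ` {F \<in> sets M. F \<subseteq> A})" for A
    by (rule bdd_aboveI[of _ C]) (use bound in \<open>fastforce simp: abs_le_iff\<close>)
  have upper: "\<nu> F \<le> p A" if "F \<in> sets M" "F \<subseteq> A" for F A
    unfolding p_def by (rule cSUP_upper[OF _ bdd]) (use that in auto)
  have least: "p A \<le> r" if "\<And>F. F \<in> sets M \<Longrightarrow> F \<subseteq> A \<Longrightarrow> \<nu> F \<le> r" for A r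
    unfolding p_def by (rule cSUP_least) (use that in auto)
  have approx: "\<exists>F\<in>sets M. F \<subseteq> A \<and> p A - e < \<nu> F" if "0 < e" for A and e :: real
  proof (rule ccontr)
    assume "\<not> ?thesis"
    then have "p A \<le> p A - e" by (intro least) (meson not_less)
    with that show False by simp
  qed
  have p0: "0 \<le> p A" for A using upper[of "{}" A] emp by simp
  have psums: "(\<lambda>i. p (A i)) sums p (\<Union>i. A i)"
    if A: "range A \<subseteq> sets M" "disjoint_family A" for A :: "nat \<Rightarrow> 'a set"
  proof -
    have part: "(\<Sum>i<n. p (A i)) \<le> p (\<Union>i. A i)" for n
    proof (rule field_le_epsilon)
      fix e :: real assume e: "0 < e"
      define d where "d = e / (real n + 1)"
      have d: "0 < d" "n * d \<le> e" using e by (auto simp: d_def field_simps)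
      have "\<forall>i. \<exists>F. F \<in> sets M \<and> F \<subseteq> A i \<and> p (A i) - d < \<nu> F"
        using approx[OF d(1)] by blast
      then obtain F where F: "\<And>i. F i \<in> sets M" "\<And>i. F i \<subseteq> A i" "\<And>i. p (A i) - d < \<nu> (F i)"
        by metis
      define G where "G i = (if i < n then F i else {})" for i
      have G: "range G \<subseteq> sets M" using F by (auto simp: G_def)
      have dis: "disjoint_family G"
        using A(2) F(2) unfolding disjoint_family_on_def G_def by (auto, blast)
      have "(\<lambda>i. \<nu> (G i)) sums (\<Sum>i<n. \<nu> (G i))"
        by (rule sums_finite) (auto simp: G_def emp)
      with sums[OF G dis] have eq: "\<nu> (\<Union>i. G i) = (\<Sum>i<n. \<nu> (G i))"
        using sums_unique2 by blast
      have "(\<Sum>i<n. p (A i)) \<le> (\<Sum>i<n. \<nu> (G i) + d)"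
        using F(3) by (intro sum_mono) (auto simp: G_def less_imp_le algebra_simps)
      also have "\<dots> = \<nu> (\<Union>i. G i) + n * d" by (simp add: sum.distrib eq)
      also have "\<nu> (\<Union>i. G i) \<le> p (\<Union>i. A i)"
        by (rule upper) (use G F(2) in \<open>auto simp: G_def split: if_splits\<close>)
      finally show "(\<Sum>i<n. p (A i)) \<le> p (\<Union>i. A i) + e" using d by simp
    qed
    have summ: "summable (\<lambda>i. p (A i))"
      by (rule summableI_nonneg_bounded[OF p0 part])
    moreover have "(\<Sum>i. p (A i)) \<le> p (\<Union>i. A i)"
      by (rule suminf_le_const[OF summ part])
    moreover have "p (\<Union>i. A i) \<le> (\<Sum>i. p (A i))"
    proof (rule least)
      fix F assume F: "F \<in> sets M" "F \<subseteq> (\<Union>i. A i)"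
      have "(\<lambda>i. \<nu> (F \<inter> A i)) sums \<nu> (\<Union>i. F \<inter> A i)"
        by (rule sums) (use A F in \<open>auto simp: disjoint_family_on_def\<close>)
      also have "(\<Union>i. F \<inter> A i) = F" using F by auto
      finally have s: "(\<lambda>i. \<nu> (F \<inter> A i)) sums \<nu> F" .
      have "(\<Sum>i. \<nu> (F \<inter> A i)) \<le> (\<Sum>i. p (A i))"
        by (rule suminf_le[OF _ sums_summable[OF s] summ]) (use A F in \<open>auto intro!: upper\<close>)
      then show "\<nu> F \<le> (\<Sum>i. p (A i))" using s by (simp add: sums_iff)
    qed
    ultimately show ?thesis by (simp add: sums_iff)
  qed
  have pnull: "p A = 0" if A: "A \<in> null_sets M" for A
  proof (rule antisym[OF _ p0])
    show "p A \<le> 0"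
    proof (rule least)
      fix F assume "F \<in> sets M" "F \<subseteq> A"
      then have "F \<in> null_sets M" using A by (meson null_sets_subset)
      then show "\<nu> F \<le> 0" using null by simp
    qed
  qed
  obtain g where g: "integrable M g" "\<And>A. A \<in> sets M \<Longrightarrow> p A = (LINT x|M. indicator A x * g x)"
    using nonneg_set_function_density[of p] p0 psums pnull by metis
  have "\<exists>h. integrable M h \<and> (\<forall>A\<in>sets M. p A - \<nu> A = (LINT x|M. indicator A x * h x))"
  proof (rule nonneg_set_function_density)
    show "0 \<le> p A - \<nu> A" if "A \<in> sets M" for A using upper[OF that] by simp
    show "(\<lambda>i. p (A i) - \<nu> (A i)) sums (p (\<Union>i. A i) - \<nu> (\<Union>i. A i))"
      if "range A \<subseteq> sets M" "disjoint_family A" for A :: "nat \<Rightarrow> 'a set"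
      by (rule sums_diff[OF psums sums]) (use that in auto)
    show "p A - \<nu> A = 0" if "A \<in> null_sets M" for A using that null pnull by simp
  qed
  then obtain h where h: "integrable M h" "\<And>A. A \<in> sets M \<Longrightarrow> p A - \<nu> A = (LINT x|M. indicator A x * h x)"
    by blast
  have "\<nu> A = (LINT x|M. indicator A x * (g x - h x))" if A: "A \<in> sets M" for A
  proof -
    have i: "integrable M (\<lambda>x. indicator A x * k x)" if "integrable M k" for k :: "'a \<Rightarrow> real"
      using integrable_mult_indicator[OF A that] by simp
    show ?thesis
      using g(2)[OF A] h(2)[OF A] i[OF g(1)] i[OF h(1)] by (simp add: right_diff_distrib)
  qed
  moreover have "integrable M (\<lambda>x. g x - h x)" using g h by simp
  ultimately show ?thesis by blast
qed

section \<open>Bounded functionals as set functions\<close>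

lemma H1_2s_two_sided:
  fixes w :: "real \<Rightarrow> 'a::{real_normed_field, euclidean_space}"
  assumes w: "w \<in> borel_measurable lebesgue" "\<And>x. norm (w x) \<le> M" "\<And>x. N < \<bar>x\<bar> \<Longrightarrow> w x = 0" "0 < N"
    and pos: "(LINT x|lebesgue. w x * indicator {0..} x) = 0"
    and neg: "(LINT x|lebesgue. w x * indicator {..<0} x) = 0"
  shows "w \<in> H1_2s" "norm_H1_2s w \<le> 2 * M * N"
proof -
  have M: "0 \<le> M" using w(2) norm_ge_zero order_trans by blast
  define S where "S j = (if j = 0 then {0..} else {..<0::real})" for j :: nat
  define a where "a j x = w x * indicator (S j) x / of_real (M * N)" for j x
  have Sm: "S j \<in> sets lebesgue" for j by (simp add: S_def)
  have m: "(\<lambda>x. w x * indicator (S j) x) \<in> borel_measurable lebesgue" for j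
    using w(1) Sm by (intro borel_measurable_times borel_measurable_indicator)
  have le: "norm (w x * indicator (S j) x) \<le> M" for j x
    using w(2)[of x] M by (auto simp: indicator_def)
  have "\<exists>I\<in>one_sided_intervals. atom_on I (a j)" for j
  proof (cases "j = 0")
    case True
    have "atom_on {0..N} (\<lambda>x. w x * indicator (S j) x / of_real (M * (N - 0)))"
      by (rule atom_on_normalized[OF w(4) m le]) (use w(3) pos True in \<open>auto simp: S_def indicator_def\<close>)
    then show ?thesis using one_sided_Icc[of 0 N] w(4) by (auto simp: a_def[abs_def])
  next
    case False
    have "atom_on {-N..0} (\<lambda>x. w x * indicator (S j) x / of_real (M * (0 - (-N))))"
      by (rule atom_on_normalized[OF _ m le]) (use w(3,4) neg False in \<open>auto simp: S_def indicator_def\<close>)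
    then show ?thesis using one_sided_Icc[of "-N" 0] w(4) by (auto simp: a_def[abs_def])
  qed
  note at = this
  have weq: "w x = (\<Sum>j<2. of_real (M * N) * a j x)" for x
  proof (cases "M = 0")
    case True
    then show ?thesis using w(2)[of x] by (simp add: a_def)
  next
    case False
    then have "of_real (M * N) * a j x = w x * indicator (S j) x" for j
      using w(4) by (simp add: a_def)
    then show ?thesis by (simp add: numeral_2_eq_2 S_def indicator_def)
  qed
  have "(\<lambda>x. \<Sum>j<2. of_real (M * N) * a j x) \<in> H1_2s"
    "norm_H1_2s (\<lambda>x. \<Sum>j<2. of_real (M * N) * a j x) \<le> (\<Sum>j<(2::nat). norm (of_real (M * N) :: 'a))"
    using H1_2s_finite[of 2 a "\<lambda>_. of_real (M * N)"] at by blast+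
  then show "w \<in> H1_2s" "norm_H1_2s w \<le> 2 * M * N"
    unfolding weq[symmetric] using M w(4) by (auto simp: norm_mult)
qed

text \<open>Subtracting multiples of two fixed indicators corrects the means over the two half-lines, so that
  every bounded test function is mapped into the atomic space.\<close>

definition normalized :: "(real \<Rightarrow> 'a::{real_normed_field, euclidean_space}) \<Rightarrow> real \<Rightarrow> 'a" where
  "normalized u x = u x - (LINT y|lebesgue. u y * indicator {0..} y) * indicator {0..<1} x
     - (LINT y|lebesgue. u y * indicator {..<0} y) * indicator {-1..<0} x"

lemma integrable_mult_indicator_field:
  fixes f :: "real \<Rightarrow> 'a::{real_normed_field, euclidean_space}"
  assumes "integrable lebesgue f" "S \<in> sets lebesgue"
  shows "integrable lebesgue (\<lambda>x. f x * indicator S x)"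
proof -
  have "f x * indicator S x = indicat_real S x *\<^sub>R f x" for x by (simp add: indicator_def)
  then show ?thesis using integrable_mult_indicator[OF assms(2,1)] by simp
qed

lemma normalized_H1_2s:
  fixes u :: "real \<Rightarrow> 'a::{real_normed_field, euclidean_space}"
  assumes u: "u \<in> borel_measurable lebesgue" "\<And>x. norm (u x) \<le> M" "\<And>x. N < \<bar>x\<bar> \<Longrightarrow> u x = 0" "1 \<le> N"
  shows "normalized u \<in> H1_2s" "norm_H1_2s (normalized u) \<le> 10 * M * N\<^sup>2"
proof -
  have M: "0 \<le> M" using u(2) norm_ge_zero order_trans by blast
  have iu: "integrable lebesgue u"
    by (rule integrable_bounded_support(1)[OF u(1,2), of "{-N..N}"]) (use u(3) in auto)
  let ?c = "\<lambda>S. LINT y|lebesgue. u y * indicator S y"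
  have c: "norm (?c S) \<le> 2 * M * N" if S: "S \<in> sets lebesgue" for S
  proof -
    have "norm (?c S) \<le> (LINT y|lebesgue. norm (u y * indicator S y))" by (rule integral_norm_bound)
    also have "\<dots> \<le> M * measure lebesgue {-N..N}"
      by (rule integrable_bounded_support(2))
        (use u M S in \<open>auto simp: indicator_def intro!: borel_measurable_times borel_measurable_indicator\<close>)
    finally show ?thesis using u(4) by simp
  qed
  have M5: "M + 2 * M * N \<le> 5 * M * N" "M \<le> 5 * M * N"
    using mult_left_mono[OF u(4) M] M by auto
  have "norm (normalized u x) \<le> 5 * M * N" for x
  proof -
    have "norm (normalized u x) \<le> norm (u x) + max (norm (?c {0..})) (norm (?c {..<0}))"
      unfolding normalized_def
      using norm_triangle_ineq4[of "u x" "?c {0..}"] norm_triangle_ineq4[of "u x" "?c {..<0}"]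
      by (auto simp: indicator_def max_def)
    moreover have "max (norm (?c {0..})) (norm (?c {..<0})) \<le> 2 * M * N"
      using c[of "{0..}"] c[of "{..<0}"] by simp
    ultimately show ?thesis using u(2)[of x] M5 by linarith
  qed
  note bound = this
  have m: "normalized u \<in> borel_measurable lebesgue"
    unfolding normalized_def[abs_def] using u(1)
    by (intro borel_measurable_diff borel_measurable_times borel_measurable_const borel_measurable_indicator) auto
  have out: "normalized u x = 0" if "N < \<bar>x\<bar>" for x
    using that u(3)[OF that] u(4) by (auto simp: normalized_def indicator_def)
  have ind: "integrable lebesgue (\<lambda>x. k * indicator {p..<q} x :: 'a)" for k and p q :: real
  proof (intro integrable_mult_right integrable_bounded_support(1)[where S = "{p..q}" and M = 1])
    show "(indicator {p..<q} :: real \<Rightarrow> 'a) \<in> borel_measurable lebesgue"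
      by (intro borel_measurable_indicator) auto
  qed (auto simp: indicator_def)
  have unit: "(LINT x|lebesgue. k * indicator {p..<p + 1} x) = (k :: 'a)" for k and p :: real
  proof -
    have eq: "k * indicator {p..<p + 1} x = indicat_real {p..<p + 1} x *\<^sub>R k" for x
      by (simp add: indicator_def)
    have "integrable lebesgue (indicat_real {p..<p + 1})"
      by (rule integrable_real_indicator) auto
    then show ?thesis unfolding eq by simp
  qed
  have split: "(LINT x|lebesgue. normalized u x * indicator S x) = ?c S
      - (LINT x|lebesgue. (?c {0..} * indicator {0..<1} x) * indicator S x)
      - (LINT x|lebesgue. (?c {..<0} * indicator {-1..<0} x) * indicator S x)" if S: "S \<in> sets lebesgue" for S
    unfolding normalized_def left_diff_distrib
    by (subst Bochner_Integration.integral_diff Bochner_Integration.integral_diff,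
        (intro Bochner_Integration.integrable_diff integrable_mult_indicator_field iu ind S)+)+ simp
  have "(LINT x|lebesgue. normalized u x * indicator {0..} x) = 0"
  proof -
    have eqs: "(k * indicator {0..<1} x) * indicator {0..} x = k * indicator {0..<0+1} x"
      "(k * indicator {-1..<0} x) * indicator {0..} x = 0" for k :: 'a and x :: real
      by (auto simp: indicator_def)
    have "{0..} \<in> sets (lebesgue :: real measure)" by simp
    from split[OF this] show ?thesis by (simp only: eqs unit) simp
  qed
  moreover have "(LINT x|lebesgue. normalized u x * indicator {..<0} x) = 0"
  proof -
    have eqs: "(k * indicator {0..<1} x) * indicator {..<0} x = 0"
      "(k * indicator {-1..<0} x) * indicator {..<0} x = k * indicator {-1..<-1+1} x" for k :: 'a and x :: real
      by (auto simp: indicator_def)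
    have "{..<0} \<in> sets (lebesgue :: real measure)" by simp
    from split[OF this] show ?thesis by (simp only: eqs unit) simp
  qed
  ultimately have *: "normalized u \<in> H1_2s" "norm_H1_2s (normalized u) \<le> 2 * (5 * M * N) * N"
    using H1_2s_two_sided[OF m bound out] u(4) by auto
  then show "normalized u \<in> H1_2s" "norm_H1_2s (normalized u) \<le> 10 * M * N\<^sup>2"
    by (simp_all add: power2_eq_square mult.assoc)
qed

lemma normalized_eq: "f \<in> H1_2s \<Longrightarrow> normalized f = f"
  by (simp add: fun_eq_iff normalized_def H1_2s_half_line_integral)

lemma normalized_add:
  assumes "bounded_test u" "bounded_test v"
  shows "normalized (\<lambda>x. u x + v x) = (\<lambda>x. normalized u x + normalized v x)"
proof -
  have "(LINT y|lebesgue. (u y + v y) * indicator S y)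
      = (LINT y|lebesgue. u y * indicator S y) + (LINT y|lebesgue. v y * indicator S y)"
    if "S \<in> sets lebesgue" for S
    unfolding distrib_right
    by (intro Bochner_Integration.integral_add integrable_mult_indicator_field bounded_test_integrable assms that)
  then show ?thesis by (simp add: fun_eq_iff normalized_def algebra_simps)
qed

lemma normalized_mult: "normalized (\<lambda>x. k * u x) = (\<lambda>x. k * normalized u x)"
  by (simp add: fun_eq_iff normalized_def algebra_simps)

lemma bounded_test_add:
  assumes "bounded_test u" "bounded_test v"
  shows "bounded_test (\<lambda>x. u x + v x)"
proof -
  obtain M N where u: "u \<in> borel_measurable lebesgue" "\<And>x. norm (u x) \<le> M" "\<And>x. N < \<bar>x\<bar> \<Longrightarrow> u x = 0"
    using assms(1) unfolding bounded_test_def by metis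
  obtain M' N' where v: "v \<in> borel_measurable lebesgue" "\<And>x. norm (v x) \<le> M'" "\<And>x. N' < \<bar>x\<bar> \<Longrightarrow> v x = 0"
    using assms(2) unfolding bounded_test_def by metis
  have "norm (u x + v x) \<le> M + M'" for x
    using norm_triangle_mono[OF u(2) v(2)] .
  moreover have "max N N' < \<bar>x\<bar> \<longrightarrow> u x + v x = 0" for x using u(3) v(3) by simp
  moreover have "(\<lambda>x. u x + v x) \<in> borel_measurable lebesgue" using u v by simp
  ultimately show ?thesis unfolding bounded_test_def by blast
qed

lemma bounded_test_mult:
  assumes "bounded_test u" "w \<in> borel_measurable lebesgue" "\<And>x. norm (w x) \<le> K"
  shows "bounded_test (\<lambda>x. w x * u x)"
proof -
  obtain M N where u: "u \<in> borel_measurable lebesgue" "\<And>x. norm (u x) \<le> M" "\<And>x. N < \<bar>x\<bar> \<Longrightarrow> u x = 0"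
    using assms(1) unfolding bounded_test_def by metis
  have "norm (w x * u x) \<le> K * M" for x
    unfolding norm_mult using order_trans[OF norm_ge_zero assms(3)]
    by (intro mult_mono assms(3) u(2)) auto
  moreover have "N < \<bar>x\<bar> \<longrightarrow> w x * u x = 0" for x using u(3) by simp
  moreover have "(\<lambda>x. w x * u x) \<in> borel_measurable lebesgue" using u assms(2) by simp
  ultimately show ?thesis unfolding bounded_test_def by blast
qed

lemma bounded_test_scale: "bounded_test u \<Longrightarrow> bounded_test (\<lambda>x. k * u x)"
  by (rule bounded_test_mult[where K = "norm k"]) auto

lemma bounded_test_zero: "bounded_test (\<lambda>x. 0)"
  by (auto simp: bounded_test_def intro: exI[of _ 0])

lemma bounded_test_indicator:
  assumes "E \<in> sets lebesgue" "bounded E"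
  shows "bounded_test (indicator E :: real \<Rightarrow> 'a::{real_normed_field, euclidean_space})"
proof -
  obtain N where "\<And>x. x \<in> E \<Longrightarrow> \<bar>x\<bar> \<le> N" using assms(2) by (auto simp: bounded_iff)
  then have "N < \<bar>x\<bar> \<longrightarrow> indicator E x = (0::'a)" for x by (force simp: indicator_def)
  moreover have "norm (indicator E x :: 'a) \<le> 1" for x by (simp add: indicator_def)
  moreover have "(indicator E :: real \<Rightarrow> 'a) \<in> borel_measurable lebesgue"
    using assms(1) by (rule borel_measurable_indicator)
  ultimately show ?thesis unfolding bounded_test_def by blast
qed

lemma bounded_test_normalized:
  assumes "bounded_test u"
  shows "normalized u \<in> H1_2s"
proof -
  obtain M N where u: "u \<in> borel_measurable lebesgue" "\<And>x. norm (u x) \<le> M" "\<And>x. N < \<bar>x\<bar> \<Longrightarrow> u x = 0"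
    using assms unfolding bounded_test_def by metis
  show ?thesis by (rule normalized_H1_2s(1)[where N = "max N 1" and M = M]) (use u in auto)
qed

lemma dual_H1_2s_bound:
  assumes "L \<in> dual_H1_2s"
  obtains B where "0 \<le> B" "\<And>f. f \<in> H1_2s \<Longrightarrow> norm (L f) \<le> B * norm_H1_2s f"
proof -
  obtain B where B: "\<And>f. f \<in> H1_2s \<Longrightarrow> norm (L f) \<le> B * norm_H1_2s f"
    using assms unfolding dual_H1_2s_def by blast
  have "norm (L f) \<le> max B 0 * norm_H1_2s f" if "f \<in> H1_2s" for f
    using B[OF that] mult_right_mono[OF max.cobounded1 norm_H1_2s_nonneg[OF that], of B 0] by linarith
  then show ?thesis using that[of "max B 0"] by simp
qed

lemma norm_le_norm_dual:
  assumes L: "L \<in> dual_H1_2s" and f: "f \<in> H1_2s" "norm_H1_2s f \<le> 1"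
  shows "norm (L f) \<le> norm_dual_H1_2s L"
  unfolding norm_dual_H1_2s_def
proof (rule cSUP_upper)
  obtain B where B: "0 \<le> B" "\<And>f. f \<in> H1_2s \<Longrightarrow> norm (L f) \<le> B * norm_H1_2s f"
    using dual_H1_2s_bound[OF L] by blast
  have "norm (L g) \<le> B" if "g \<in> H1_2s" "norm_H1_2s g \<le> 1" for g
    using B(2)[OF that(1)] mult_left_mono[OF that(2) B(1)] by simp
  then show "bdd_above ((\<lambda>f. norm (L f)) ` {f \<in> H1_2s. norm_H1_2s f \<le> 1})"
    by (intro bdd_aboveI[of _ B]) auto
qed (use f in auto)

text \<open>A bounded functional, fixed for the construction of its representing function.\<close>

locale dual_functional =
  fixes L :: "(real \<Rightarrow> 'a::{real_normed_field, euclidean_space}) \<Rightarrow> 'a"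
  assumes dual: "L \<in> dual_H1_2s"
begin

text \<open>A linear extension of the functional to all bounded test functions. Its values on indicators of
  sets form the set function whose density is the representing function.\<close>

definition extension :: "(real \<Rightarrow> 'a) \<Rightarrow> 'a" where
  "extension u = L (normalized u)"

lemma L_add: "f \<in> H1_2s \<Longrightarrow> g \<in> H1_2s \<Longrightarrow> L (\<lambda>x. f x + g x) = L f + L g"
  using dual by (simp add: dual_H1_2s_def)

lemma L_scale: "f \<in> H1_2s \<Longrightarrow> L (\<lambda>x. k * f x) = k * L f"
  using dual by (simp add: dual_H1_2s_def)

lemma ext_add: "bounded_test u \<Longrightarrow> bounded_test v \<Longrightarrow> extension (\<lambda>x. u x + v x) = extension u + extension v"
  by (simp add: extension_def normalized_add L_add bounded_test_normalized)

lemma ext_scale: "bounded_test u \<Longrightarrow> extension (\<lambda>x. k * u x) = k * extension u"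
  by (simp add: extension_def normalized_mult L_scale bounded_test_normalized)

lemma ext_zero: "extension (\<lambda>x. 0) = 0"
  using ext_scale[OF bounded_test_zero, of 0] by simp

lemma ext_eq: "f \<in> H1_2s \<Longrightarrow> extension f = L f"
  by (simp add: extension_def normalized_eq)

lemma ext_sum:
  assumes "finite A" "\<And>i. i \<in> A \<Longrightarrow> bounded_test (u i)"
  shows "bounded_test (\<lambda>x. \<Sum>i\<in>A. u i x) \<and> extension (\<lambda>x. \<Sum>i\<in>A. u i x) = (\<Sum>i\<in>A. extension (u i))"
  using assms by (induction A rule: finite_induct) (auto simp: bounded_test_zero bounded_test_add ext_zero ext_add)

text \<open>Continuity under bounded convergence in mean. For a fixed height \<open>h\<close> the bad part of
  the decomposition tends to zero with the mean, and the good part contributes a multiple of \<open>h\<close>.\<close>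

lemma ext_tendsto_zero:
  fixes u :: "nat \<Rightarrow> real \<Rightarrow> 'a" and n :: int
  assumes u: "\<And>k. u k \<in> borel_measurable lebesgue" "\<And>k x. norm (u k x) \<le> M"
    and zero: "\<And>k x. x \<notin> {of_int n..<of_int n + 1} \<Longrightarrow> u k x = 0"
    and lim: "(\<lambda>k. LINT x|lebesgue. norm (u k x)) \<longlonglongrightarrow> 0"
  shows "(\<lambda>k. extension (u k)) \<longlonglongrightarrow> 0"
proof -
  obtain B where B: "0 \<le> B" "\<And>f. f \<in> H1_2s \<Longrightarrow> norm (L f) \<le> B * norm_H1_2s f"
    using dual_H1_2s_bound[OF dual] by blast
  define N where "N = \<bar>real_of_int n\<bar> + 1"
  have N: "1 \<le> N" "x \<notin> {of_int n..<of_int n + 1}" if "N < \<bar>x\<bar>" for x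
    using that by (auto simp: N_def)
  have N1: "1 \<le> N" by (simp add: N_def)
  have M: "0 \<le> M" using u(2) norm_ge_zero order_trans by blast
  have est: "norm (extension w) \<le> B * (2 * M / h * (LINT x|lebesgue. norm (w x))) + B * (10 * (2 * h) * N\<^sup>2)"
    if w: "w \<in> borel_measurable lebesgue" "\<And>x. norm (w x) \<le> M"
      "\<And>x. x \<notin> {of_int n..<of_int n + 1} \<Longrightarrow> w x = 0"
      and h: "0 < h" "(LINT x|lebesgue. norm (w x)) \<le> h" for w h
  proof -
    obtain v where v: "v \<in> borel_measurable lebesgue" "\<And>x. norm (v x) \<le> 2 * h"
      "\<And>x. x \<notin> {of_int n..<of_int n + 1} \<Longrightarrow> v x = 0"
      and b: "(\<lambda>x. w x - v x) \<in> H1_2s"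
      "norm_H1_2s (\<lambda>x. w x - v x) \<le> 2 * M / h * (LINT x|lebesgue. norm (w x))"
      using Calderon_Zygmund_decomposition[where n = n, OF w h] by blast
    have btv: "bounded_test v" using v N(2) unfolding bounded_test_def by blast
    have btw: "bounded_test w" using w N(2) unfolding bounded_test_def by blast
    have btb: "bounded_test (\<lambda>x. w x - v x)"
      using bounded_test_add[OF btw bounded_test_scale[OF btv, of "-1"]] by simp
    have "extension w = L (\<lambda>x. w x - v x) + extension v"
      using ext_add[OF btb btv] ext_eq[OF b(1)] by simp
    then have "norm (extension w) \<le> norm (L (\<lambda>x. w x - v x)) + norm (extension v)"
      by (simp add: norm_triangle_ineq)
    moreover have "norm (L (\<lambda>x. w x - v x)) \<le> B * (2 * M / h * (LINT x|lebesgue. norm (w x)))"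
      using B(2)[OF b(1)] mult_left_mono[OF b(2) B(1)] by linarith
    moreover have "norm (extension v) \<le> B * (10 * (2 * h) * N\<^sup>2)"
    proof -
      have nv: "normalized v \<in> H1_2s" "norm_H1_2s (normalized v) \<le> 10 * (2 * h) * N\<^sup>2"
        using normalized_H1_2s[OF v(1,2) _ N1] v(3) N(2) by blast+
      show ?thesis
        unfolding extension_def using B(2)[OF nv(1)] mult_left_mono[OF nv(2) B(1)] by linarith
    qed
    ultimately show ?thesis by linarith
  qed
  show ?thesis
  proof (rule LIMSEQ_I)
    fix e :: real assume e: "0 < e"
    define K where "K = 40 * (B + 1) * N\<^sup>2"
    define h where "h = e / K"
    have pos: "0 < K" using B(1) N1 by (simp add: K_def)
    have h: "0 < h" using e pos by (simp add: h_def)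
    have "B * (10 * (2 * h) * N\<^sup>2) \<le> (B + 1) * (10 * (2 * h) * N\<^sup>2)"
      using h by (intro mult_right_mono) auto
    also have "\<dots> = K * h / 2" by (simp add: K_def)
    also have "\<dots> = e / 2" using pos by (simp add: h_def)
    finally have half: "B * (10 * (2 * h) * N\<^sup>2) \<le> e / 2" .
    have "(\<lambda>k. B * (2 * M / h * (LINT x|lebesgue. norm (u k x)))) \<longlonglongrightarrow> B * (2 * M / h * 0)"
      by (intro tendsto_mult_left lim)
    then have "eventually (\<lambda>k. B * (2 * M / h * (LINT x|lebesgue. norm (u k x))) < e / 2) sequentially"
      using e by (intro order_tendstoD(2)) auto
    moreover have "eventually (\<lambda>k. (LINT x|lebesgue. norm (u k x)) < h) sequentially"
      using lim h by (rule order_tendstoD(2))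
    ultimately have "eventually (\<lambda>k. norm (extension (u k)) < e) sequentially"
    proof eventually_elim
      case (elim k)
      then show ?case using est[OF u zero h less_imp_le[OF elim(2)]] half by linarith
    qed
    then show "\<exists>k0. \<forall>k\<ge>k0. norm (extension (u k) - 0) < e"
      by (simp add: eventually_sequentially)
  qed
qed

end

section \<open>The density of a bounded functional\<close>

context dual_functional
begin

lemma ext_indicator_sums:
  fixes A :: "nat \<Rightarrow> real set" and n :: int
  assumes A: "\<And>i. A i \<in> sets lebesgue" "\<And>i. A i \<subseteq> {of_int n..<of_int n + 1}" "disjoint_family A"
  shows "(\<lambda>i. extension (indicator (A i))) sums extension (indicator (\<Union>i. A i))"
proof -
  let ?J = "{real_of_int n..<of_int n + 1}"
  have Jlm: "?J \<in> lmeasurable" by (rule bounded_set_imp_lmeasurable) auto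
  \<comment> \<open>the remainders decrease to the empty set, so their measures tend to zero\<close>
  define R where "R k = (\<Union>i. A i) - (\<Union>i<k. A i)" for k
  have Rs: "R k \<in> sets lebesgue" for k using A(1) by (auto simp: R_def)
  have RJ: "R k \<subseteq> ?J" for k using A(2) by (auto simp: R_def)
  have Rlm: "R k \<in> lmeasurable" for k using fmeasurableI2[OF Jlm RJ Rs] .
  have bt: "bounded_test (indicator E :: real \<Rightarrow> 'a)" if "E \<in> sets lebesgue" "E \<subseteq> ?J" for E
    using that(1) bounded_subset[OF _ that(2)] by (intro bounded_test_indicator) auto
  have "(\<Inter>k. R k) = {}" by (auto simp: R_def)
  moreover have "(\<lambda>k. measure lebesgue (R k)) \<longlonglongrightarrow> measure lebesgue (\<Inter>k. R k)"
    by (rule Lim_measure_decseq)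
      (use Rs fmeasurableD2[OF Rlm] in \<open>auto simp: decseq_def R_def\<close>)
  ultimately have "(\<lambda>k. measure lebesgue (R k)) \<longlonglongrightarrow> 0" by simp
  moreover have "(LINT x|lebesgue. norm (indicator (R k) x :: 'a)) = measure lebesgue (R k)" for k
  proof -
    have "norm (indicator (R k) x :: 'a) = indicat_real (R k) x" for x by (simp add: indicator_def)
    then show ?thesis using Rs[of k] by simp
  qed
  ultimately have "(\<lambda>k. LINT x|lebesgue. norm (indicator (R k) x :: 'a)) \<longlonglongrightarrow> 0" by simp
  then have lim: "(\<lambda>k. extension (indicator (R k))) \<longlonglongrightarrow> 0"
  proof (rule ext_tendsto_zero[where n = n and M = 1, rotated 3])
    show "indicator (R k) x = (0::'a)" if "x \<notin> ?J" for k x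
    proof -
      have "x \<notin> R k" using RJ[of k] that by blast
      then show ?thesis by simp
    qed
  qed (use Rs in \<open>auto simp: indicator_def intro!: borel_measurable_indicator\<close>)
  have "(\<Sum>i<k. extension (indicator (A i))) = extension (indicator (\<Union>i. A i)) - extension (indicator (R k))" for k
  proof -
    have "indicator (\<Union>i. A i) x = (\<Sum>i<k. indicator (A i) x) + (indicator (R k) x :: 'a)" for x
    proof -
      have "(\<Sum>i<k. indicator (A i) x) = (indicator (\<Union>i<k. A i) x :: 'a)"
        using A(3) by (intro indicator_UN_disjoint[symmetric]) (auto simp: disjoint_family_on_def)
      then show ?thesis by (auto simp: R_def indicator_def)
    qed
    then have eq: "indicator (\<Union>i. A i) = (\<lambda>x. (\<Sum>i<k. indicator (A i) x) + (indicator (R k) x :: 'a))"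
      by (rule ext)
    have s: "bounded_test (\<lambda>x. \<Sum>i<k. indicator (A i) x :: 'a) \<and>
        extension (\<lambda>x. \<Sum>i<k. indicator (A i) x) = (\<Sum>i<k. extension (indicator (A i)))"
      by (rule ext_sum) (use bt A in auto)
    show ?thesis unfolding eq using ext_add[OF conjunct1[OF s] bt[OF Rs RJ]] s by simp
  qed
  moreover have "(\<lambda>k. extension (indicator (\<Union>i. A i)) - extension (indicator (R k))) \<longlonglongrightarrow> extension (indicator (\<Union>i. A i)) - 0"
    by (intro tendsto_intros lim)
  ultimately show ?thesis by (simp add: sums_def)
qed

lemma ext_indicator_bounded:
  fixes n :: int
  obtains C where "\<And>E. E \<in> sets lebesgue \<Longrightarrow> E \<subseteq> {of_int n..<of_int n + 1} \<Longrightarrow> norm (extension (indicator E)) \<le> C"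
proof -
  obtain B where B: "0 \<le> B" "\<And>f. f \<in> H1_2s \<Longrightarrow> norm (L f) \<le> B * norm_H1_2s f"
    using dual_H1_2s_bound[OF dual] by blast
  define N where "N = \<bar>real_of_int n\<bar> + 1"
  have "norm (extension (indicator E)) \<le> B * (10 * 1 * N\<^sup>2)"
    if E: "E \<in> sets lebesgue" "E \<subseteq> {of_int n..<of_int n + 1}" for E
  proof -
    have "x \<notin> E" if "N < \<bar>x\<bar>" for x using that E(2) by (auto simp: N_def subset_iff)
    then have out: "indicator E x = (0::'a)" if "N < \<bar>x\<bar>" for x using that by simp
    have m: "(indicator E :: real \<Rightarrow> 'a) \<in> borel_measurable lebesgue"
      using E(1) by (rule borel_measurable_indicator)
    have "norm (indicator E x :: 'a) \<le> 1" for x by (simp add: indicator_def)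
    from normalized_H1_2s[OF m this out] have
      n: "normalized (indicator E :: real \<Rightarrow> 'a) \<in> H1_2s"
         "norm_H1_2s (normalized (indicator E :: real \<Rightarrow> 'a)) \<le> 10 * 1 * N\<^sup>2"
      by (auto simp: N_def)
    show ?thesis unfolding extension_def using B(2)[OF n(1)] mult_left_mono[OF n(2) B(1)] by linarith
  qed
  with that show ?thesis by blast
qed

lemma ext_indicator_null:
  fixes n :: int
  assumes "E \<in> null_sets lebesgue" "E \<subseteq> {of_int n..<of_int n + 1}"
  shows "extension (indicator E) = 0"
proof -
  have E: "E \<in> sets lebesgue" using assms(1) by auto
  have "(\<lambda>k::nat. extension (indicator E)) \<longlonglongrightarrow> 0"
  proof (rule ext_tendsto_zero[where n = n and M = 1])
    show "indicator E x = (0::'a)" if "x \<notin> {of_int n..<of_int n + 1}" for x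
      using that assms(2) by (auto simp: indicator_def)
    have "norm (indicator E x :: 'a) = indicat_real E x" for x by (simp add: indicator_def)
    then have "(LINT x|lebesgue. norm (indicator E x :: 'a)) = 0"
      using assms(1) E by (simp add: measure_eq_0_null_sets)
    then show "(\<lambda>k::nat. LINT x|lebesgue. norm (indicator E x :: 'a)) \<longlonglongrightarrow> 0" by simp
  qed (use E in \<open>auto simp: indicator_def intro!: borel_measurable_indicator\<close>)
  then show ?thesis by (simp add: LIMSEQ_const_iff)
qed

text \<open>Radon--Nikodym is applied to each coordinate of the set function.\<close>

lemma ext_indicator_density:
  fixes n :: int
  obtains \<psi> :: "real \<Rightarrow> 'a" where "integrable lebesgue \<psi>"
    "\<And>x. x \<notin> {of_int n..<of_int n + 1} \<Longrightarrow> \<psi> x = 0"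
    "\<And>E. E \<in> sets lebesgue \<Longrightarrow> E \<subseteq> {of_int n..<of_int n + 1} \<Longrightarrow>
       extension (indicator E) = (LINT x|lebesgue. indicator E x * \<psi> x)"
proof -
  let ?J = "{real_of_int n..<of_int n + 1}"
  let ?M = "lebesgue_on ?J"
  have Jlm: "?J \<in> lmeasurable" by (rule bounded_set_imp_lmeasurable) auto
  then have Js: "?J \<in> sets lebesgue" by (rule fmeasurableD)
  interpret finite_measure ?M by (rule finite_measure_lebesgue_on[OF Jlm])
  have sM: "A \<in> sets ?M \<longleftrightarrow> A \<in> sets lebesgue \<and> A \<subseteq> ?J" for A
    using Js by (auto simp: sets_restrict_space_iff)
  obtain C where C: "\<And>E. E \<in> sets lebesgue \<Longrightarrow> E \<subseteq> ?J \<Longrightarrow> norm (extension (indicator E)) \<le> C"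
    using ext_indicator_bounded[of n] by blast
  have "\<exists>g. integrable ?M g \<and> (\<forall>A\<in>sets ?M. extension (indicator A) \<bullet> b = (LINT x|?M. indicator A x * g x))"
    if b: "b \<in> Basis" for b
  proof (rule signed_set_function_density)
    show "\<bar>extension (indicator A) \<bullet> b\<bar> \<le> C" if "A \<in> sets ?M" for A
      using Basis_le_norm[OF b, of "extension (indicator A)"] C[of A] that sM by (meson order_trans)
    show "(\<lambda>i. extension (indicator (A i)) \<bullet> b) sums (extension (indicator (\<Union>i. A i)) \<bullet> b)"
      if "range A \<subseteq> sets ?M" "disjoint_family A" for A :: "nat \<Rightarrow> real set"
    proof -
      have "A i \<in> sets lebesgue \<and> A i \<subseteq> ?J" for i using that(1) sM by blast
      then show ?thesis
        by (intro bounded_linear.sums[OF bounded_linear_inner_left] ext_indicator_sums that(2)) auto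
    qed
    show "extension (indicator A) \<bullet> b = 0" if "A \<in> null_sets ?M" for A
    proof -
      have "A \<in> null_sets lebesgue" "A \<subseteq> ?J"
        using that null_sets_restrict_space[OF Js] by auto
      then show ?thesis using ext_indicator_null by simp
    qed
  qed
  then obtain g where g: "\<And>b. b \<in> Basis \<Longrightarrow> integrable ?M (g b)"
    "\<And>b A. b \<in> Basis \<Longrightarrow> A \<in> sets ?M \<Longrightarrow> extension (indicator A) \<bullet> b = (LINT x|?M. indicator A x * g b x)"
    by metis
  have gi: "integrable lebesgue (\<lambda>x. indicat_real ?J x * g b x)" if "b \<in> Basis" for b
    using g(1)[OF that] Js by (simp add: integrable_restrict_space)
  have ge: "extension (indicator A) \<bullet> b = (LINT x|lebesgue. indicat_real A x * (indicat_real ?J x * g b x))"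
    if b: "b \<in> Basis" and A: "A \<in> sets lebesgue" "A \<subseteq> ?J" for b A
  proof -
    have "extension (indicator A) \<bullet> b = (LINT x|?M. indicator A x * g b x)" using g(2) b A sM by blast
    also have "\<dots> = (LINT x|lebesgue. indicat_real ?J x *\<^sub>R (indicator A x * g b x))"
      using Js by (intro integral_restrict_space) auto
    finally show ?thesis by (simp add: mult.left_commute)
  qed
  define \<psi> :: "real \<Rightarrow> 'a" where "\<psi> x = (\<Sum>b\<in>Basis. (indicat_real ?J x * g b x) *\<^sub>R b)" for x
  have i: "integrable lebesgue (\<lambda>x. indicat_real A x * (indicat_real ?J x * g b x))"
    if "b \<in> Basis" "A \<in> sets lebesgue" for A b
    using integrable_mult_indicator[OF that(2) gi[OF that(1)]] by simp
  have "integrable lebesgue \<psi>"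
    unfolding \<psi>_def[abs_def]
    by (intro Bochner_Integration.integrable_sum integrable_scaleR_left gi)
  moreover have "\<psi> x = 0" if "x \<notin> ?J" for x using that by (simp add: \<psi>_def)
  moreover have "extension (indicator A) = (LINT x|lebesgue. indicator A x * \<psi> x)"
    if A: "A \<in> sets lebesgue" "A \<subseteq> ?J" for A
  proof -
    have "indicator A x * \<psi> x = (\<Sum>b\<in>Basis. (indicat_real A x * (indicat_real ?J x * g b x)) *\<^sub>R b)" for x
      by (cases "x \<in> A") (simp_all add: \<psi>_def)
    then have "(LINT x|lebesgue. indicator A x * \<psi> x)
        = (LINT x|lebesgue. (\<Sum>b\<in>Basis. (indicat_real A x * (indicat_real ?J x * g b x)) *\<^sub>R b))" by simp
    also have "\<dots> = (\<Sum>b\<in>Basis. (LINT x|lebesgue. (indicat_real A x * (indicat_real ?J x * g b x)) *\<^sub>R b))"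
      by (intro Bochner_Integration.integral_sum integrable_scaleR_left i A)
    also have "\<dots> = (\<Sum>b\<in>Basis. (extension (indicator A) \<bullet> b) *\<^sub>R b)"
      using i A ge by (intro sum.cong refl) simp
    finally show ?thesis by (simp add: euclidean_representation)
  qed
  ultimately show ?thesis using that by blast
qed

text \<open>From indicators to bounded functions by approximation with simple functions.\<close>

lemma ext_local_density:
  fixes n :: int
  shows "\<exists>\<psi>. integrable lebesgue \<psi> \<and> (\<forall>x. x \<notin> {of_int n..<of_int n + 1} \<longrightarrow> \<psi> x = 0) \<and>
    (\<forall>u. bounded_test u \<longrightarrow> (\<forall>x. x \<notin> {of_int n..<of_int n + 1} \<longrightarrow> u x = 0) \<longrightarrow>
       extension u = (LINT x|lebesgue. u x * \<psi> x))"
proof -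
  let ?J = "{real_of_int n..<of_int n + 1}"
  have Jlm: "?J \<in> lmeasurable" by (rule bounded_set_imp_lmeasurable) auto
  obtain \<psi> :: "real \<Rightarrow> 'a" where \<psi>: "integrable lebesgue \<psi>" "\<And>x. x \<notin> ?J \<Longrightarrow> \<psi> x = 0"
    "\<And>E. E \<in> sets lebesgue \<Longrightarrow> E \<subseteq> ?J \<Longrightarrow> extension (indicator E) = (LINT x|lebesgue. indicator E x * \<psi> x)"
    using ext_indicator_density[of n] by blast
  have \<psi>m: "\<psi> \<in> borel_measurable lebesgue" using \<psi>(1) by auto
  have "extension u = (LINT x|lebesgue. u x * \<psi> x)"
    if bu: "bounded_test u" and zero: "\<And>x. x \<notin> ?J \<Longrightarrow> u x = 0" for u
  proof -
    obtain M where um: "u \<in> borel_measurable lebesgue" and uM: "\<And>x. norm (u x) \<le> M"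
      using bu unfolding bounded_test_def by blast
    have M: "0 \<le> M" using uM norm_ge_zero order_trans by blast
    from borel_measurable_implies_sequence_metric[OF um, of 0] obtain s :: "nat \<Rightarrow> real \<Rightarrow> 'a" where
      s: "\<And>i. simple_function lebesgue (s i)" "\<And>x. (\<lambda>i. s i x) \<longlonglongrightarrow> u x"
        "\<And>i x. norm (s i x) \<le> 2 * norm (u x)"
      by auto
    have sm: "s i \<in> borel_measurable lebesgue" for i
      using s(1) by (rule borel_measurable_simple_function)
    have sM: "norm (s i x) \<le> 2 * M" for i x using s(3)[of i x] uM[of x] by linarith
    have s0: "s i x = 0" if "x \<notin> ?J" for i x using s(3)[of i x] zero[OF that] by simp
    have bts: "bounded_test (s i)" for i
    proof -
      obtain N where "\<forall>x. N < \<bar>x\<bar> \<longrightarrow> u x = 0" using bu unfolding bounded_test_def by blast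
      then have "\<forall>x. N < \<bar>x\<bar> \<longrightarrow> s i x = 0" using s(3)[of i] by (metis mult_zero_right norm_le_zero_iff norm_zero)
      then show ?thesis using sm sM unfolding bounded_test_def by blast
    qed
    have step: "extension (s i) = (LINT x|lebesgue. s i x * \<psi> x)" for i
    proof -
      let ?E = "\<lambda>y. s i -` {y}" and ?Y = "range (s i) - {0}"
      have fin: "finite ?Y" using simple_functionD(1)[OF s(1)[of i]] by simp
      have Es: "?E y \<in> sets lebesgue" for y using simple_functionD(2)[OF s(1)[of i], of "{y}"] by simp
      have EJ: "?E y \<subseteq> ?J" if "y \<in> ?Y" for y using s0 that by blast
      have btE: "bounded_test (indicator (?E y) :: real \<Rightarrow> 'a)" if "y \<in> ?Y" for y
        by (intro bounded_test_indicator Es bounded_subset[OF _ EJ[OF that]]) auto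
      have eq: "s i = (\<lambda>x. \<Sum>y\<in>?Y. y * indicator (?E y) x)"
      proof
        fix x
        have "(\<Sum>y\<in>?Y. y * indicator (?E y) x) = (\<Sum>y\<in>?Y. if y = s i x then y else 0)"
          by (intro sum.cong) (auto simp: indicator_def)
        also have "\<dots> = s i x" using fin by (auto simp: sum.delta)
        finally show "s i x = (\<Sum>y\<in>?Y. y * indicator (?E y) x)" ..
      qed
      have iE: "integrable lebesgue (\<lambda>x. indicator (?E y) x * \<psi> x)" for y
        using integrable_mult_indicator_field[OF \<psi>(1) Es[of y]] by (simp add: mult.commute)
      have "extension (s i) = extension (\<lambda>x. \<Sum>y\<in>?Y. y * indicator (?E y) x)"
        using eq by (rule arg_cong)
      also have "\<dots> = (\<Sum>y\<in>?Y. extension (\<lambda>x. y * indicator (?E y) x))"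
        by (rule ext_sum[OF fin, THEN conjunct2]) (rule bounded_test_scale[OF btE])
      also have "\<dots> = (\<Sum>y\<in>?Y. y * (LINT x|lebesgue. indicator (?E y) x * \<psi> x))"
        using btE EJ Es by (intro sum.cong refl) (simp add: ext_scale \<psi>(3))
      also have "\<dots> = (LINT x|lebesgue. (\<Sum>y\<in>?Y. y * (indicator (?E y) x * \<psi> x)))"
        using iE by simp
      also have "\<dots> = (LINT x|lebesgue. s i x * \<psi> x)"
      proof -
        have "s i x * \<psi> x = (\<Sum>y\<in>?Y. y * indicator (?E y) x) * \<psi> x" for x
          by (rule arg_cong[OF fun_cong[OF eq], of "\<lambda>t. t * \<psi> x"])
        then have "(\<Sum>y\<in>?Y. y * (indicator (?E y) x * \<psi> x)) = s i x * \<psi> x" for x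
          by (simp only: sum_distrib_right mult.assoc)
        then show ?thesis by (simp only:)
      qed
      finally show ?thesis .
    qed
    have btd: "bounded_test (\<lambda>x. u x - s i x)" for i
      using bounded_test_add[OF bu bounded_test_scale[OF bts, of "-1" i]] by simp
    have L1: "(\<lambda>i. LINT x|lebesgue. norm (u x - s i x)) \<longlonglongrightarrow> (LINT x::real|lebesgue. (0::real))"
    proof (rule integral_dominated_convergence[where w = "\<lambda>x. indicat_real ?J x * (3 * M)"])
      show "integrable lebesgue (\<lambda>x. indicat_real ?J x * (3 * M))"
        using Jlm by (intro integrable_mult_left integrable_real_indicator) (auto simp: fmeasurable_def)
      have "(\<lambda>i. norm (u x - s i x)) \<longlonglongrightarrow> norm (u x - u x)" for x
        by (intro tendsto_intros s(2))
      then show "AE x in lebesgue. (\<lambda>i. norm (u x - s i x)) \<longlonglongrightarrow> 0" by simp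
      have "norm (norm (u x - s i x)) \<le> indicat_real ?J x * (3 * M)" for i x
      proof (cases "x \<in> ?J")
        case True
        then show ?thesis using norm_triangle_ineq4[of "u x" "s i x"] uM[of x] sM[of i x] by simp
      next
        case False
        then show ?thesis using zero s0 by simp
      qed
      then show "AE x in lebesgue. norm (norm (u x - s i x)) \<le> indicat_real ?J x * (3 * M)" for i by simp
    qed (use um sm in auto)
    have "(\<lambda>i. extension (\<lambda>x. u x - s i x)) \<longlonglongrightarrow> 0"
    proof (rule ext_tendsto_zero[where n = n and M = "3 * M"])
      show "norm (u x - s i x) \<le> 3 * M" for i x
        using norm_triangle_ineq4[of "u x" "s i x"] uM[of x] sM[of i x] by linarith
    qed (use um sm zero s0 L1 in auto)
    moreover have "extension (\<lambda>x. u x - s i x) = extension u - (LINT x|lebesgue. s i x * \<psi> x)" for i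
      using ext_add[OF btd bts, of i i] step[of i] by simp
    ultimately have "(\<lambda>i. extension u - (LINT x|lebesgue. s i x * \<psi> x)) \<longlonglongrightarrow> 0" by simp
    moreover have "(\<lambda>i. LINT x|lebesgue. s i x * \<psi> x) \<longlonglongrightarrow> (LINT x|lebesgue. u x * \<psi> x)"
    proof (rule integral_dominated_convergence[where w = "\<lambda>x. 2 * M * norm (\<psi> x)"])
      show "integrable lebesgue (\<lambda>x. 2 * M * norm (\<psi> x))"
        by (intro integrable_mult_right integrable_norm \<psi>(1))
      show "AE x in lebesgue. (\<lambda>i. s i x * \<psi> x) \<longlonglongrightarrow> u x * \<psi> x"
        by (intro always_eventually allI tendsto_mult_right s(2))
      show "AE x in lebesgue. norm (s i x * \<psi> x) \<le> 2 * M * norm (\<psi> x)" for i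
        unfolding norm_mult by (intro always_eventually allI mult_right_mono sM) auto
    qed (use um sm \<psi>m in auto)
    then have "(\<lambda>i. extension u - (LINT x|lebesgue. s i x * \<psi> x)) \<longlonglongrightarrow> extension u - (LINT x|lebesgue. u x * \<psi> x)"
      by (intro tendsto_intros)
    ultimately show ?thesis using LIMSEQ_unique by fastforce
  qed
  with \<psi> show ?thesis by blast
qed

text \<open>The local densities are glued along the unit intervals; \<open>\<lfloor>x\<rfloor>\<close> is the index of the
  interval containing \<open>x\<close>.\<close>

lemma ext_density:
  obtains \<phi> :: "real \<Rightarrow> 'a" where "locally_integrable \<phi>" "\<And>u. bounded_test u \<Longrightarrow> extension u = L_functional \<phi> u"
proof -
  let ?J = "\<lambda>n::int. {real_of_int n..<of_int n + 1}"
  obtain \<Psi> :: "int \<Rightarrow> real \<Rightarrow> 'a" where \<Psi>: "\<And>n. integrable lebesgue (\<Psi> n)" "\<And>n x. x \<notin> ?J n \<Longrightarrow> \<Psi> n x = 0"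
    "\<And>n u. bounded_test u \<Longrightarrow> (\<And>x. x \<notin> ?J n \<Longrightarrow> u x = 0) \<Longrightarrow> extension u = (LINT x|lebesgue. u x * \<Psi> n x)"
    using ext_local_density by metis
  define \<phi> where "\<phi> x = \<Psi> \<lfloor>x\<rfloor> x" for x
  have memJ: "x \<in> ?J n \<longleftrightarrow> n = \<lfloor>x\<rfloor>" for x n
    using floor_eq_iff[of x n] by auto
  have fl: "\<lfloor>x\<rfloor> \<in> {-N..N}" if "\<bar>x\<bar> \<le> of_int N" for x :: real and N
    using that by (auto simp: le_floor_iff floor_le_iff abs_le_iff)
  have \<phi>_sum: "\<phi> x = (\<Sum>n\<in>{-N..N}. \<Psi> n x)" if "\<bar>x\<bar> \<le> of_int N" for x N
  proof -
    have "(\<Sum>n\<in>{-N..N}. \<Psi> n x) = (\<Sum>n\<in>{-N..N}. if n = \<lfloor>x\<rfloor> then \<Psi> n x else 0)"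
      using \<Psi>(2) memJ by (intro sum.cong) auto
    then show ?thesis using fl[OF that] by (simp add: \<phi>_def)
  qed
  have "locally_integrable \<phi>"
    unfolding locally_integrable_def set_integrable_def
  proof (intro allI impI)
    fix K :: "real set" assume K: "compact K"
    then obtain r where "\<forall>x\<in>K. norm x \<le> r" using compact_imp_bounded bounded_iff by metis
    then have r: "\<bar>x\<bar> \<le> r" if "x \<in> K" for x using that by auto
    have "indicat_real K x *\<^sub>R \<phi> x = indicat_real K x *\<^sub>R (\<Sum>n\<in>{-\<lceil>r\<rceil>..\<lceil>r\<rceil>}. \<Psi> n x)" for x
    proof (cases "x \<in> K")
      case True
      then have "\<bar>x\<bar> \<le> of_int \<lceil>r\<rceil>" using r[of x] le_of_int_ceiling[of r] by linarith
      then show ?thesis by (simp add: \<phi>_sum)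
    qed simp
    moreover have "integrable lebesgue (\<lambda>x. indicat_real K x *\<^sub>R (\<Sum>n\<in>{-\<lceil>r\<rceil>..\<lceil>r\<rceil>}. \<Psi> n x))"
      using fmeasurableD[OF lmeasurable_compact[OF K]] \<Psi>(1)
      by (intro integrable_mult_indicator Bochner_Integration.integrable_sum)
    ultimately show "integrable lebesgue (\<lambda>x. indicat_real K x *\<^sub>R \<phi> x)" by (simp only:)
  qed
  moreover have "extension u = L_functional \<phi> u" if u: "bounded_test u" for u
  proof -
    obtain r where r: "\<And>x. r < \<bar>x\<bar> \<Longrightarrow> u x = 0" using u unfolding bounded_test_def by blast
    define N where "N = \<lceil>r\<rceil>"
    have out: "u x = 0" if "\<not> \<bar>x\<bar> \<le> of_int N" for x
    proof (rule r)
      show "r < \<bar>x\<bar>" using that le_of_int_ceiling[of r] unfolding N_def by linarith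
    qed
    have bt: "bounded_test (\<lambda>x. indicator (?J n) x * u x)" for n
    proof (rule bounded_test_mult[OF u, where K = 1])
      show "(indicator (?J n) :: real \<Rightarrow> 'a) \<in> borel_measurable lebesgue"
        by (rule borel_measurable_indicator) simp
    qed (simp add: indicator_def)
    have eq: "u x = (\<Sum>n\<in>{-N..N}. indicator (?J n) x * u x)" for x
    proof (cases "\<bar>x\<bar> \<le> of_int N")
      case True
      have "(\<Sum>n\<in>{-N..N}. indicator (?J n) x * u x) = (\<Sum>n\<in>{-N..N}. if n = \<lfloor>x\<rfloor> then u x else 0)"
        using memJ[of x] by (intro sum.cong) (auto simp: indicator_def)
      then show ?thesis using fl[OF True] by simp
    qed (use out in simp)
    have ii: "integrable lebesgue (\<lambda>x. u x * \<Psi> n x)" for n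
    proof -
      obtain M where um: "u \<in> borel_measurable lebesgue" and uM: "\<And>x. norm (u x) \<le> M"
        using u unfolding bounded_test_def by blast
      have "norm (u x * \<Psi> n x) \<le> norm (M * norm (\<Psi> n x))" for x
        using mult_right_mono[OF uM norm_ge_zero, of x "\<Psi> n x"] order_trans[OF norm_ge_zero uM]
        by (simp add: norm_mult abs_mult)
      then show ?thesis
        by (intro Bochner_Integration.integrable_bound[OF integrable_mult_right[OF integrable_norm[OF \<Psi>(1)]]])
          (use um borel_measurable_integrable[OF \<Psi>(1)] in auto)
    qed
    have "extension u = extension (\<lambda>x. \<Sum>n\<in>{-N..N}. indicator (?J n) x * u x)" using eq by presburger
    also have "\<dots> = (\<Sum>n\<in>{-N..N}. extension (\<lambda>x. indicator (?J n) x * u x))"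
      using ext_sum[of "{-N..N}" "\<lambda>n x. indicator (?J n) x * u x"] bt by blast
    also have "\<dots> = (\<Sum>n\<in>{-N..N}. (LINT x|lebesgue. u x * \<Psi> n x))"
    proof (rule sum.cong[OF refl])
      fix n
      have "extension (\<lambda>x. indicator (?J n) x * u x) = (LINT x|lebesgue. (indicator (?J n) x * u x) * \<Psi> n x)"
        by (rule \<Psi>(3)[OF bt]) simp
      moreover have "(indicator (?J n) x * u x) * \<Psi> n x = u x * \<Psi> n x" for x
        using \<Psi>(2)[of x n] by (cases "x \<in> ?J n") auto
      ultimately show "extension (\<lambda>x. indicator (?J n) x * u x) = (LINT x|lebesgue. u x * \<Psi> n x)" by simp
    qed
    also have "\<dots> = (LINT x|lebesgue. (\<Sum>n\<in>{-N..N}. u x * \<Psi> n x))" using ii by simp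
    also have "\<dots> = (LINT x|lebesgue. u x * \<phi> x)"
    proof -
      have "(\<Sum>n\<in>{-N..N}. u x * \<Psi> n x) = u x * \<phi> x" for x
        by (cases "\<bar>x\<bar> \<le> of_int N") (simp_all add: \<phi>_sum out sum_distrib_left)
      then show ?thesis by simp
    qed
    finally show ?thesis by (simp add: L_functional_def)
  qed
  ultimately show ?thesis using that by blast
qed

section \<open>Comparison of the norms\<close>

text \<open>The mean oscillation on \<open>I\<close> is read off from a multiple of the atom obtained by subtracting from
  \<open>s = \<bar>z\<bar> / z\<close>, where \<open>z = \<phi> - \<phi>\<^sub>I\<close>, its mean over \<open>I\<close>: here \<open>s z = \<bar>z\<bar>\<close>, and \<open>s = 0\<close> where
  \<open>z = 0\<close>. The factor 2 bounds \<open>s\<close> minus its mean.\<close>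

lemma mean_osc_le_norm_dual:
  assumes \<phi>: "locally_integrable \<phi>" "\<And>u. bounded_test u \<Longrightarrow> extension u = L_functional \<phi> u"
    and I: "I \<in> one_sided_intervals"
  shows "mean_osc I \<phi> \<le> 2 * norm_dual_H1_2s L"
proof -
  obtain a b where ab: "a < b" "I \<subseteq> {a..b}" "measure lebesgue I = b - a" "0 \<le> a \<or> b \<le> 0"
    using one_sided_subset_Icc[OF I] by blast
  have bI: "bounded_interval I" using one_sided_bounded_interval[OF I] .
  have Ilm: "I \<in> lmeasurable" using bounded_interval_lmeasurable[OF bI] .
  then have Is: "I \<in> sets lebesgue" by (rule fmeasurableD)
  define l where "l = b - a"
  have l: "0 < l" "measure lebesgue I = l" using ab by (auto simp: l_def)
  define m where "m = mean_on I \<phi>"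
  define s where "s x = (of_real (norm (\<phi> x - m)) :: 'a) / (\<phi> x - m)" for x
  have \<phi>m: "\<phi> \<in> borel_measurable lebesgue" by (rule locally_integrable_measurable[OF \<phi>(1)])
  have sm: "s \<in> borel_measurable lebesgue"
    unfolding s_def[abs_def] of_real_def using \<phi>m
    by (intro borel_measurable_divide borel_measurable_scaleR borel_measurable_norm) auto
  have s1: "norm (s x) \<le> 1" for x by (simp add: s_def norm_divide)
  have sz: "s x * (\<phi> x - m) = of_real (norm (\<phi> x - m))" for x by (simp add: s_def)
  have Im: "(\<lambda>x. indicat_real I x *\<^sub>R s x) \<in> borel_measurable lebesgue"
    using Is sm by (intro borel_measurable_scaleR borel_measurable_indicator)
  have Ile: "norm (indicat_real I x *\<^sub>R s x) \<le> 1" for x using s1[of x] by (simp add: indicator_def)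
  have is_int: "integrable lebesgue (\<lambda>x. indicat_real I x *\<^sub>R s x)"
    by (rule integrable_bounded_support(1)[OF Im Ile Ilm]) simp
  define sI where "sI = (1 / l) *\<^sub>R (LINT x|lebesgue. indicat_real I x *\<^sub>R s x)"
  have sI1: "norm sI \<le> 1"
  proof -
    have "norm (LINT x|lebesgue. indicat_real I x *\<^sub>R s x) \<le> (LINT x|lebesgue. norm (indicat_real I x *\<^sub>R s x))"
      by (rule integral_norm_bound)
    also have "\<dots> \<le> 1 * l"
      using integrable_bounded_support(2)[OF Im Ile Ilm] l by simp
    finally show ?thesis using l by (simp add: sI_def)
  qed
  have iI: "integrable lebesgue (indicat_real I)"
    using Ilm by (intro integrable_real_indicator) (auto simp: fmeasurable_def)
  have intI: "(LINT x|lebesgue. indicat_real I x *\<^sub>R k) = l *\<^sub>R k" for k :: 'a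
    using iI Is l by simp
  define f where "f x = indicat_real I x *\<^sub>R (s x - sI)" for x
  have fm: "f \<in> borel_measurable lebesgue"
    unfolding f_def[abs_def] using Is sm
    by (intro borel_measurable_scaleR borel_measurable_indicator borel_measurable_diff) auto
  have f2: "norm (f x) \<le> 2" for x
    using norm_triangle_ineq4[of "s x" sI] s1[of x] sI1 by (auto simp: f_def indicator_def)
  have f0: "f x = 0" if "x \<notin> {a..b}" for x using that ab(2) by (auto simp: f_def indicator_def)
  have fint: "(LINT x|lebesgue. f x) = 0"
  proof -
    have "(LINT x|lebesgue. f x) = (LINT x|lebesgue. indicat_real I x *\<^sub>R s x) - (LINT x|lebesgue. indicat_real I x *\<^sub>R sI)"
      unfolding f_def scaleR_diff_right
      by (rule Bochner_Integration.integral_diff[OF is_int]) (use iI in \<open>auto intro: integrable_scaleR_left\<close>)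
    then show ?thesis unfolding intI using l by (simp add: sI_def)
  qed
  define c where "c = (of_real (2 * l) :: 'a)"
  have c: "c \<noteq> 0" "norm c = 2 * l" using l by (auto simp: c_def norm_mult)
  have at: "atom_on {a..b} (\<lambda>x. f x / c)"
    using atom_on_normalized[OF ab(1) fm f2 f0 fint] by (simp add: c_def l_def)
  have os: "{a..b} \<in> one_sided_intervals" by (rule one_sided_Icc[OF ab(1,4)])
  note H = H1_2s_atom[OF os at]
  have bt: "bounded_test (\<lambda>x. f x / c)" by (rule atom_bounded_test[OF at])
  have Lf: "L (\<lambda>x. f x / c) = (LINT x|lebesgue. f x / c * \<phi> x)"
    using ext_eq[OF H(1)] \<phi>(2)[OF bt] by (simp add: L_functional_def)
  have i\<phi>: "integrable lebesgue (\<lambda>x. indicat_real I x *\<^sub>R \<phi> x)"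
    by (rule locally_integrable_on_interval[OF \<phi>(1) bI])
  have i\<phi>m: "integrable lebesgue (\<lambda>x. indicat_real I x *\<^sub>R (\<phi> x - m))"
    unfolding scaleR_diff_right using i\<phi> iI by (intro Bochner_Integration.integrable_diff integrable_scaleR_left)
  have z: "(LINT x|lebesgue. indicat_real I x *\<^sub>R (\<phi> x - m)) = 0"
  proof -
    have "(LINT x|lebesgue. indicat_real I x *\<^sub>R (\<phi> x - m))
        = (LINT x|lebesgue. indicat_real I x *\<^sub>R \<phi> x) - (LINT x|lebesgue. indicat_real I x *\<^sub>R m)"
      unfolding scaleR_diff_right
      by (rule Bochner_Integration.integral_diff[OF i\<phi>]) (use iI in \<open>auto intro: integrable_scaleR_left\<close>)
    then show ?thesis unfolding intI using l by (simp add: m_def mean_on_def set_lebesgue_integral_def)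
  qed
  define V where "V = (LINT x|lebesgue. indicat_real I x * norm (\<phi> x - m))"
  have iO: "integrable lebesgue (\<lambda>x. indicat_real I x * norm (\<phi> x - m))"
    by (rule integrable_oscillation[OF \<phi>(1) bI])
  have "(LINT x|lebesgue. f x / c * \<phi> x) = of_real V / c"
  proof -
    have eq: "f x / c * \<phi> x = (of_real (indicat_real I x * norm (\<phi> x - m)) - sI * (indicat_real I x *\<^sub>R (\<phi> x - m)) + f x * m) / c" for x
    proof (cases "x \<in> I")
      case True
      then have "f x * \<phi> x = (s x - sI) * (\<phi> x - m) + f x * m"
        by (simp add: f_def algebra_simps)
      also have "\<dots> = of_real (norm (\<phi> x - m)) - sI * (\<phi> x - m) + f x * m"
        using sz[of x] by (simp add: left_diff_distrib)
      finally show ?thesis using True by simp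
    qed (simp add: f_def)
    have if_int: "integrable lebesgue f"
      by (rule integrable_bounded_support(1)[OF fm f2, of "{a..b}"]) (use f0 in auto)
    have "(LINT x|lebesgue. of_real (indicat_real I x * norm (\<phi> x - m)) - sI * (indicat_real I x *\<^sub>R (\<phi> x - m)) + f x * m)
        = of_real V - sI * 0 + 0 * m"
    proof (subst Bochner_Integration.integral_add)
      show "integrable lebesgue (\<lambda>x. of_real (indicat_real I x * norm (\<phi> x - m)) - sI * (indicat_real I x *\<^sub>R (\<phi> x - m)))"
        by (intro Bochner_Integration.integrable_diff integrable_of_real iO integrable_mult_right i\<phi>m)
      show "integrable lebesgue (\<lambda>x. f x * m)" by (intro integrable_mult_left if_int)
      have "(LINT x|lebesgue. of_real (indicat_real I x * norm (\<phi> x - m)) - sI * (indicat_real I x *\<^sub>R (\<phi> x - m)))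
          = (LINT x|lebesgue. (of_real (indicat_real I x * norm (\<phi> x - m)) :: 'a)) - (LINT x|lebesgue. sI * (indicat_real I x *\<^sub>R (\<phi> x - m)))"
        by (intro Bochner_Integration.integral_diff integrable_of_real iO integrable_mult_right i\<phi>m)
      moreover have "(LINT x|lebesgue. (of_real (indicat_real I x * norm (\<phi> x - m)) :: 'a)) = of_real V"
        unfolding V_def by (rule integral_of_real) (rule iO)
      moreover have "(LINT x|lebesgue. sI * (indicat_real I x *\<^sub>R (\<phi> x - m))) = sI * 0"
        by (subst Bochner_Integration.integral_mult_right) (use i\<phi>m z in simp_all)
      moreover have "(LINT x|lebesgue. f x * m) = 0 * m"
        by (subst Bochner_Integration.integral_mult_left) (use if_int fint in simp_all)
      ultimately show "(LINT x|lebesgue. of_real (indicat_real I x * norm (\<phi> x - m)) - sI * (indicat_real I x *\<^sub>R (\<phi> x - m)))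
          + (LINT x|lebesgue. f x * m) = of_real V - sI * 0 + 0 * m" by simp
    qed
    then show ?thesis unfolding eq by simp
  qed
  moreover have "0 \<le> V" unfolding V_def by (intro integral_nonneg_AE) auto
  ultimately have "norm (L (\<lambda>x. f x / c)) = V / (2 * l)"
    using Lf c by (simp add: norm_divide)
  then have "V / (2 * l) \<le> norm_dual_H1_2s L"
    using norm_le_norm_dual[OF dual H] by simp
  moreover have "mean_osc I \<phi> = V / l"
    using l by (simp add: mean_osc_def V_def m_def set_lebesgue_integral_def)
  moreover have "V / (2 * l) = V / l / 2" by simp
  ultimately show ?thesis by linarith
qed

text \<open>By boundedness the functional may be evaluated on an atomic series term by term, and on a single
  atom its value is at most the norm of \<open>\<phi>\<close>.\<close>

lemma norm_dual_le_norm_BMO: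
  assumes \<phi>: "\<phi> \<in> BMO_2s" "\<And>u. bounded_test u \<Longrightarrow> extension u = L_functional \<phi> u"
  shows "norm_dual_H1_2s L \<le> norm_BMO_2s \<phi>"
proof (rule norm_dual_H1_2s_leI[OF norm_BMO_2s_nonneg[OF \<phi>(1)]])
  fix f :: "real \<Rightarrow> 'a" assume f: "f \<in> H1_2s"
  let ?K = "norm_BMO_2s \<phi>"
  obtain B where B: "0 \<le> B" "\<And>f. f \<in> H1_2s \<Longrightarrow> norm (L f) \<le> B * norm_H1_2s f"
    using dual_H1_2s_bound[OF dual] by blast
  show "norm (L f) \<le> ?K * norm_H1_2s f"
  proof (rule le_mult_norm_H1_2s[OF f norm_BMO_2s_nonneg[OF \<phi>(1)]])
    fix c a assume d: "atomic_decomp_2s f c a"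
    have at: "\<exists>I\<in>one_sided_intervals. atom_on I (a j)" for j using d unfolding atomic_decomp_2s_def by blast
    have sc: "summable (\<lambda>j. norm (c j))" using d by (simp add: atomic_decomp_2s_def)
    have aH: "a j \<in> H1_2s" for j using at H1_2s_atom(1) by blast
    have La: "norm (L (a j)) \<le> ?K" for j
    proof -
      obtain I where I: "I \<in> one_sided_intervals" "atom_on I (a j)" using at by blast
      have "L (a j) = L_functional \<phi> (a j)"
        using ext_eq[OF aH] \<phi>(2)[OF atom_bounded_test[OF I(2)]] by simp
      then show ?thesis using L_functional_atom_le[OF \<phi>(1) I] by simp
    qed
    have PH: "(\<lambda>x. \<Sum>j<n. c j * a j x) \<in> H1_2s" for n by (rule H1_2s_finite(1)[OF at])
    have cH: "(\<lambda>x. c j * a j x) \<in> H1_2s" for j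
      using H1_2s_finite(1)[where n = 1 and a = "\<lambda>_. a j" and c = "\<lambda>_. c j"] at[of j] by simp
    have LP: "L (\<lambda>x. \<Sum>j<n. c j * a j x) = (\<Sum>j<n. c j * L (a j))" for n
    proof (induction n)
      case 0
      show ?case using ext_zero ext_eq[OF H1_2s_zero(1)] by simp
    next
      case (Suc n)
      then show ?case using L_add[OF PH[of n] cH[of n]] L_scale[OF aH[of n], of "c n"] by simp
    qed
    have bound: "norm (L f) \<le> ?K * (\<Sum>j. norm (c j)) + B * (\<Sum>j. norm (c (j + n)))" for n
    proof -
      let ?P = "\<lambda>x. \<Sum>j<n. c j * a j x" and ?r = "\<lambda>x. f x - (\<Sum>j<n. c j * a j x)"
      note t = atomic_decomp_2s_tail[OF d, of n]
      have rH: "?r \<in> H1_2s" using t unfolding H1_2s_def by blast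
      have "L f = L ?P + L ?r" using L_add[OF PH[of n] rH] by simp
      then have "norm (L f) \<le> norm (L ?P) + norm (L ?r)" by (simp add: norm_triangle_ineq)
      moreover have "norm (L ?r) \<le> B * (\<Sum>j. norm (c (j + n)))"
        using B(2)[OF rH] mult_left_mono[OF norm_H1_2s_le[OF t] B(1)] by linarith
      moreover have "norm (L ?P) \<le> ?K * (\<Sum>j. norm (c j))"
      proof -
        have "norm (L ?P) \<le> (\<Sum>j<n. norm (c j) * ?K)"
          unfolding LP by (rule order_trans[OF norm_sum]) (auto intro!: sum_mono mult_left_mono La simp: norm_mult)
        also have "\<dots> = ?K * (\<Sum>j<n. norm (c j))" by (simp add: sum_distrib_left mult.commute)
        also have "\<dots> \<le> ?K * (\<Sum>j. norm (c j))"
          by (intro mult_left_mono sum_le_suminf sc norm_BMO_2s_nonneg[OF \<phi>(1)]) auto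
        finally show ?thesis .
      qed
      ultimately show ?thesis by linarith
    qed
    have "(\<lambda>n. ?K * (\<Sum>j. norm (c j)) + B * (\<Sum>j. norm (c (j + n)))) \<longlonglongrightarrow> ?K * (\<Sum>j. norm (c j)) + B * 0"
      by (intro tendsto_intros suminf_exist_split2 sc)
    then show "norm (L f) \<le> ?K * (\<Sum>j. norm (c j))"
      using bound by (intro LIMSEQ_le_const[of _ "?K * (\<Sum>j. norm (c j))"]) auto
  qed
qed

lemma BMO_representation:
  obtains \<phi> where "\<phi> \<in> BMO_2s" "norm_BMO_2s \<phi> \<le> 2 * norm_dual_H1_2s L" "norm_dual_H1_2s L \<le> norm_BMO_2s \<phi>"
    "\<And>f. f \<in> H1_2s \<Longrightarrow> bounded_compactly_supported f \<Longrightarrow> L f = L_functional \<phi> f"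
proof -
  obtain \<phi> :: "real \<Rightarrow> 'a" where \<phi>: "locally_integrable \<phi>" "\<And>u. bounded_test u \<Longrightarrow> extension u = L_functional \<phi> u"
    using ext_density by blast
  note osc = mean_osc_le_norm_dual[OF \<phi>]
  have B: "\<phi> \<in> BMO_2s"
    using \<phi>(1) osc unfolding BMO_2s_def by (auto intro!: bdd_aboveI2)
  have "norm_BMO_2s \<phi> \<le> 2 * norm_dual_H1_2s L"
    unfolding norm_BMO_2s_def by (rule cSUP_least[OF one_sided_intervals_nonempty osc])
  moreover have "L f = L_functional \<phi> f" if "f \<in> H1_2s" "bounded_compactly_supported f" for f
    using ext_eq[OF that(1)] \<phi>(2)[OF bounded_test_if_supp[OF that(2) borel_measurable_integrable[OF H1_2s_integrable[OF that(1)]]]]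
    by simp
  ultimately show ?thesis using that B norm_dual_le_norm_BMO[OF B \<phi>(2)] by blast
qed

end

section \<open>Duality\<close>

theorem theorem2p2:
  shows "(\<exists>c>0. \<forall>\<phi>\<in>(BMO_2s :: (real \<Rightarrow> 'a::{real_normed_field, euclidean_space}) set).
            \<exists>L\<in>dual_H1_2s.
              (\<forall>f\<in>H1_2s. bounded_compactly_supported f \<longrightarrow> L f = L_functional \<phi> f) \<and>
              norm_dual_H1_2s L \<le> c * norm_BMO_2s \<phi>)
       \<and> (\<exists>c>0. \<exists>C>0. \<forall>L\<in>(dual_H1_2s :: ((real \<Rightarrow> 'a) \<Rightarrow> 'a) set).
            \<exists>\<phi>\<in>BMO_2s.
              norm_BMO_2s \<phi> \<le> c * norm_dual_H1_2s L \<and>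
              norm_dual_H1_2s L \<le> C * norm_BMO_2s \<phi> \<and>
              (\<forall>f\<in>H1_2s. bounded_compactly_supported f \<longrightarrow> L f = L_functional \<phi> f))"
proof (intro conjI)
  show "\<exists>c>0. \<forall>\<phi>\<in>(BMO_2s :: (real \<Rightarrow> 'a) set). \<exists>L\<in>dual_H1_2s.
          (\<forall>f\<in>H1_2s. bounded_compactly_supported f \<longrightarrow> L f = L_functional \<phi> f) \<and>
          norm_dual_H1_2s L \<le> c * norm_BMO_2s \<phi>"
  proof (intro exI[of _ 1] conjI ballI)
    fix \<phi> :: "real \<Rightarrow> 'a" assume \<phi>: "\<phi> \<in> BMO_2s"
    have "norm_dual_H1_2s (BMO_functional \<phi>) \<le> norm_BMO_2s \<phi>"
      by (intro norm_dual_H1_2s_leI norm_BMO_2s_nonneg norm_BMO_functional_le \<phi>)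
    then show "\<exists>L\<in>dual_H1_2s. (\<forall>f\<in>H1_2s. bounded_compactly_supported f \<longrightarrow> L f = L_functional \<phi> f) \<and>
          norm_dual_H1_2s L \<le> 1 * norm_BMO_2s \<phi>"
      using BMO_functional_dual[OF \<phi>] BMO_functional_eq[OF \<phi>] by auto
  qed simp
  show "\<exists>c>0. \<exists>C>0. \<forall>L\<in>(dual_H1_2s :: ((real \<Rightarrow> 'a) \<Rightarrow> 'a) set). \<exists>\<phi>\<in>BMO_2s.
          norm_BMO_2s \<phi> \<le> c * norm_dual_H1_2s L \<and> norm_dual_H1_2s L \<le> C * norm_BMO_2s \<phi> \<and>
          (\<forall>f\<in>H1_2s. bounded_compactly_supported f \<longrightarrow> L f = L_functional \<phi> f)"
  proof (rule exI[of _ "2::real"], rule conjI, simp, rule exI[of _ "1::real"], rule conjI, simp, rule ballI)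
    fix L :: "(real \<Rightarrow> 'a) \<Rightarrow> 'a" assume "L \<in> dual_H1_2s"
    then interpret dual_functional L by unfold_locales
    obtain \<phi> where "\<phi> \<in> BMO_2s" "norm_BMO_2s \<phi> \<le> 2 * norm_dual_H1_2s L" "norm_dual_H1_2s L \<le> norm_BMO_2s \<phi>"
      "\<And>f. f \<in> H1_2s \<Longrightarrow> bounded_compactly_supported f \<Longrightarrow> L f = L_functional \<phi> f"
      using BMO_representation by blast
    then show "\<exists>\<phi>\<in>BMO_2s. norm_BMO_2s \<phi> \<le> 2 * norm_dual_H1_2s L \<and>
          norm_dual_H1_2s L \<le> 1 * norm_BMO_2s \<phi> \<and>
          (\<forall>f\<in>H1_2s. bounded_compactly_supported f \<longrightarrow> L f = L_functional \<phi> f)" by auto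
  qed
qed

end
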